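(* Let $G$ be a factorizable graph and let $\mathrm{Aux}(G)=(V(G),A)$ be the digraph obtained by running Algorithm 1 (described in the context) on $G$. Then a subgraph $H$ of $G$ belongs to $\mathcal{G}(G)$ if and only if $H=G[V(D)]$ for some strongly connected component $D$ of $\mathrm{Aux}(G)$ (equivalently, the vertex sets of factor-components are exactly the vertex sets of strongly connected components of $\mathrm{Aux}(G)$). Moreover, for any $H_1,H_2\in\mathcal{G}(G)$, $H_1\trianglelefteq H_2$ holds if and only if $D_1\rightarrow D_2$, where $D_i$ is the strongly connected component of $\mathrm{Aux}(G)$ with $V(D_i)=V(H_i)$ for $i=1,2$, and $D_1\rightarrow D_2$ means that for every $u\in V(D_1)$ and $v\in V(D_2)$ there is a directed path from $u$ to $v$ in $\mathrm{Aux}(G)$.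
   Context: All graphs are finite. A graph is factorizable if it has a perfect matching, factor-critical if deleting any vertex yields the empty graph or a factorizable graph. $G/X$ contracts $X$ to one vertex, $\Gamma(X)$ = vertices outside $X$ adjacent to $X$. For factorizable $G$: an edge is allowed if in some perfect matching; for each connected component $C$ of the subgraph of allowed edges, $G[V(C)]$ is a factor-component; $\mathcal{G}(G)$ is their set; $X$ is separating if every factor-component is inside or disjoint from $X$. $G_1\trianglelefteq G_2$ (for $G_1,G_2\in\mathcal{G}(G)$) if there is a separating $X\supseteq V(G_1)\cup V(G_2)$ with $G[X]/V(G_1)$ factor-critical. For any graph $H$, $D(H)$ is the set of vertices exposed by some maximum matching and $A(H)=\Gamma(D(H))$. For $X\subseteq V(G)$: $D_X$ = vertices of odd components $K_1,\ldots,K_l$ of $G-X$, $C_X=V(G)\setminus X\setminus D_X$, and $G_X:=(G-C_X-E(G[X]))/V(K_1)/\cdots/V(K_l)$ (delete $C_X$, delete edges inside $X$, contract each $K_i$), bipartite with classes $X$ and the contracted vertices. DM-components of a bipartite factorizable graph are its factor-components. The expansion of a DM-component $D$ of $G_X$ is $G[(V(D)\cap X)\cup\bigcup V(K_i)]$ over the $K_i$ whose contracted vertex lies in $D$. Algorithm 1 (input: factorizable $G$): compute a perfect matching $M$; set $U:=V(G)$, $f\equiv 0$ on $V(G)$, arc set $A:=\emptyset$, $\mathcal{P}:=\emptyset$. While $U\neq\emptyset$: choose $u\in U$; compute $X:=A(G-u)\cup\{u\}$; compute the DM-components of $G_X$; for each DM-component $D$: let $S:=X\cap V(D)$, choose any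 $v\in S$; if $f(v)=0$: add $S$ to $\mathcal{P}$, let $\hat D$ be the expansion of $D$, and for every $x\in S$ add the arcs $(x,y)$ for all $y\in V(\hat D)\setminus X$ to $A$, remove $x$ from $U$ and set $f(x):=1$. Finally output $\mathcal{P}$ and the digraph $\mathrm{Aux}(G)=(V(G),A)$ with its strongly connected components. *)

theory Defs
  imports "Graph_Theory.Digraph_Component"
begin

record 'a ugraph =
  nodes :: "'a set"
  edges :: "'a set set"

definition simple_graph :: "'a ugraph \<Rightarrow> bool" where
  "simple_graph G \<longleftrightarrow> (\<forall>e\<in>edges G. e \<subseteq> nodes G \<and> card e = 2)"

definition finite_graph :: "'a ugraph \<Rightarrow> bool" where
  "finite_graph G \<longleftrightarrow> simple_graph G \<and> finite (nodes G)"

definition sub_ugraph :: "'a ugraph \<Rightarrow> 'a ugraph \<Rightarrow> bool" where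
  "sub_ugraph H G \<longleftrightarrow> simple_graph H \<and> nodes H \<subseteq> nodes G \<and> edges H \<subseteq> edges G"

definition induce :: "'a ugraph \<Rightarrow> 'a set \<Rightarrow> 'a ugraph" where
  "induce G X = \<lparr> nodes = nodes G \<inter> X, edges = {e \<in> edges G. e \<subseteq> X} \<rparr>"

definition delete_nodes :: "'a ugraph \<Rightarrow> 'a set \<Rightarrow> 'a ugraph" where
  "delete_nodes G X = induce G (nodes G - X)"

definition delete_edges :: "'a ugraph \<Rightarrow> 'a set set \<Rightarrow> 'a ugraph" where
  "delete_edges G F = \<lparr> nodes = nodes G, edges = edges G - F \<rparr>"

text \<open>
  Simultaneous contraction of the members of a family \<open>P\<close> of nonempty, pairwise disjoint vertex
  sets. The vertices of the result are the members of \<open>P\<close> (each being the vertex it is contracted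
  to) and the singletons \<open>{v}\<close> of the remaining vertices \<open>v\<close>. For disjoint sets this is the same,
  up to renaming of vertices, as contracting them one after the other, and
  \<open>contract G {X}\<close> is \<open>G/X\<close>. Loops are dropped and parallel edges are identified.
\<close>

definition contract_nodes :: "'a ugraph \<Rightarrow> 'a set set \<Rightarrow> 'a set set" where
  "contract_nodes G P = P \<union> (\<lambda>v. {v}) ` (nodes G - \<Union>P)"

definition contract :: "'a ugraph \<Rightarrow> 'a set set \<Rightarrow> 'a set ugraph" where
  "contract G P =
    \<lparr> nodes = contract_nodes G P,
      edges = {{B, C} | B C. B \<in> contract_nodes G P \<and> C \<in> contract_nodes G P \<and> B \<noteq> C \<and>
                             (\<exists>b\<in>B. \<exists>c\<in>C. {b, c} \<in> edges G)} \<rparr>"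

definition neighbours :: "'a ugraph \<Rightarrow> 'a set \<Rightarrow> 'a set" where
  "neighbours G X = {v \<in> nodes G - X. \<exists>x\<in>X. {x, v} \<in> edges G}"

definition component_sets :: "'a ugraph \<Rightarrow> 'a set set" where
  "component_sets G =
    nodes G // {(u, v). u \<in> nodes G \<and> v \<in> nodes G \<and> (u, v) \<in> {(x, y). {x, y} \<in> edges G}\<^sup>*}"

definition matching :: "'a ugraph \<Rightarrow> 'a set set \<Rightarrow> bool" where
  "matching G M \<longleftrightarrow> M \<subseteq> edges G \<and> (\<forall>e\<in>M. \<forall>f\<in>M. e \<noteq> f \<longrightarrow> e \<inter> f = {})"

definition exposed :: "'a ugraph \<Rightarrow> 'a set set \<Rightarrow> 'a set" where
  "exposed G M = nodes G - \<Union>M"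

definition perfect_matching :: "'a ugraph \<Rightarrow> 'a set set \<Rightarrow> bool" where
  "perfect_matching G M \<longleftrightarrow> matching G M \<and> exposed G M = {}"

definition maximum_matching :: "'a ugraph \<Rightarrow> 'a set set \<Rightarrow> bool" where
  "maximum_matching G M \<longleftrightarrow> matching G M \<and> (\<forall>N. matching G N \<longrightarrow> card N \<le> card M)"

definition factorizable :: "'a ugraph \<Rightarrow> bool" where
  "factorizable G \<longleftrightarrow> (\<exists>M. perfect_matching G M)"

definition factor_critical :: "'a ugraph \<Rightarrow> bool" where
  "factor_critical G \<longleftrightarrow>
    (\<forall>v\<in>nodes G. nodes (delete_nodes G {v}) = {} \<or> factorizable (delete_nodes G {v}))"

definition set_D :: "'a ugraph \<Rightarrow> 'a set" where
  "set_D H = {v. \<exists>M. maximum_matching H M \<and> v \<in> exposed H M}"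

definition set_A :: "'a ugraph \<Rightarrow> 'a set" where
  "set_A H = neighbours H (set_D H)"

definition allowed :: "'a ugraph \<Rightarrow> 'a set \<Rightarrow> bool" where
  "allowed G e \<longleftrightarrow> e \<in> edges G \<and> (\<exists>M. perfect_matching G M \<and> e \<in> M)"

definition allowed_subgraph :: "'a ugraph \<Rightarrow> 'a ugraph" where
  "allowed_subgraph G = \<lparr> nodes = nodes G, edges = {e. allowed G e} \<rparr>"

definition factor_components :: "'a ugraph \<Rightarrow> 'a ugraph set" where
  "factor_components G = induce G ` component_sets (allowed_subgraph G)"

definition separating :: "'a ugraph \<Rightarrow> 'a set \<Rightarrow> bool" where
  "separating G X \<longleftrightarrow>
    X \<subseteq> nodes G \<and> (\<forall>H\<in>factor_components G. nodes H \<subseteq> X \<or> nodes H \<inter> X = {})"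

definition fc_le :: "'a ugraph \<Rightarrow> 'a ugraph \<Rightarrow> 'a ugraph \<Rightarrow> bool"
    (\<open>_ \<unlhd>\<^bsub>_\<^esub> _\<close> [51, 0, 51] 50) where
  "H\<^sub>1 \<unlhd>\<^bsub>G\<^esub> H\<^sub>2 \<longleftrightarrow>
    (\<exists>X. separating G X \<and> nodes H\<^sub>1 \<union> nodes H\<^sub>2 \<subseteq> X \<and>
         factor_critical (contract (induce G X) {nodes H\<^sub>1}))"

definition odd_components :: "'a ugraph \<Rightarrow> 'a set \<Rightarrow> 'a set set" where
  "odd_components G X = {K \<in> component_sets (delete_nodes G X). odd (card K)}"

definition D_of :: "'a ugraph \<Rightarrow> 'a set \<Rightarrow> 'a set" where
  "D_of G X = \<Union>(odd_components G X)"

definition C_of :: "'a ugraph \<Rightarrow> 'a set \<Rightarrow> 'a set" where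
  "C_of G X = nodes G - X - D_of G X"

text \<open>
  A vertex \<open>x \<in> X\<close> becomes the vertex \<open>{x}\<close> of this graph, and the odd component \<open>K\<close> becomes
  the vertex \<open>K\<close>.
\<close>

definition bip_graph :: "'a ugraph \<Rightarrow> 'a set \<Rightarrow> 'a set ugraph" where
  "bip_graph G X =
    contract (delete_edges (delete_nodes G (C_of G X)) (edges (induce G X))) (odd_components G X)"

abbreviation (input) DM_components :: "'a ugraph \<Rightarrow> 'a ugraph set" where
  "DM_components B \<equiv> factor_components B"

definition X_part :: "'a set \<Rightarrow> 'a set ugraph \<Rightarrow> 'a set" where
  "X_part X D = {x \<in> X. {x} \<in> nodes D}"

definition expansion :: "'a ugraph \<Rightarrow> 'a set \<Rightarrow> 'a set ugraph \<Rightarrow> 'a ugraph" where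
  "expansion G X D = induce G (X_part X D \<union> \<Union>{K \<in> odd_components G X. K \<in> nodes D})"

text \<open>
  The algorithm makes arbitrary choices (of the perfect matching, of the vertex \<open>u\<close>, of the order
  in which the DM-components are treated, and of the vertex \<open>v\<close>), so it is given as a big-step
  relation between its input and its possible outputs. The fields of the state are the program
  variables \<open>U\<close>, \<open>f\<close>, \<open>A\<close> and the family of classes, in this order.
\<close>

record 'a alg_state =
  var_U :: "'a set"
  var_f :: "'a \<Rightarrow> nat"
  var_A :: "('a \<times> 'a) set"
  var_P :: "'a set set"

definition register :: "'a ugraph \<Rightarrow> 'a set \<Rightarrow> 'a set ugraph \<Rightarrow> 'a alg_state \<Rightarrow> 'a alg_state" where
  "register G X D s =
    \<lparr> var_U = var_U s - X_part X D,
      var_f = (\<lambda>x. if x \<in> X_part X D then 1 else var_f s x),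
      var_A = var_A s \<union> X_part X D \<times> (nodes (expansion G X D) - X),
      var_P = insert (X_part X D) (var_P s) \<rparr>"

inductive treat_component ::
    "'a ugraph \<Rightarrow> 'a set \<Rightarrow> 'a set ugraph \<Rightarrow> 'a alg_state \<Rightarrow> 'a alg_state \<Rightarrow> bool"
  for G X D s where
  new: "v \<in> X_part X D \<Longrightarrow> var_f s v = 0 \<Longrightarrow> treat_component G X D s (register G X D s)"
| old: "v \<in> X_part X D \<Longrightarrow> var_f s v \<noteq> 0 \<Longrightarrow> treat_component G X D s s"

inductive for_each_component ::
    "'a ugraph \<Rightarrow> 'a set \<Rightarrow> 'a set ugraph set \<Rightarrow> 'a alg_state \<Rightarrow> 'a alg_state \<Rightarrow> bool"
  for G X where
  for_done: "for_each_component G X {} s s"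
| for_step: "D \<in> \<D> \<Longrightarrow> treat_component G X D s s' \<Longrightarrow> for_each_component G X (\<D> - {D}) s' s''
    \<Longrightarrow> for_each_component G X \<D> s s''"

inductive while_loop :: "'a ugraph \<Rightarrow> 'a alg_state \<Rightarrow> 'a alg_state \<Rightarrow> bool"
  for G where
  while_done: "var_U s = {} \<Longrightarrow> while_loop G s s"
| while_step: "u \<in> var_U s \<Longrightarrow> X = set_A (delete_nodes G {u}) \<union> {u}
    \<Longrightarrow> for_each_component G X (DM_components (bip_graph G X)) s s'
    \<Longrightarrow> while_loop G s' s'' \<Longrightarrow> while_loop G s s''"

text \<open>
  \<open>algorithm_output G \<P> Aux\<close>: some run of the algorithm on \<open>G\<close> ends with the output \<open>\<P>\<close>, \<open>Aux\<close>.
  The perfect matching \<open>M\<close> only serves to compute the sets \<open>X\<close> and the DM-components efficiently;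
  neither these nor the output depend on it.
\<close>

definition algorithm_output ::
    "'a ugraph \<Rightarrow> 'a set set \<Rightarrow> 'a pair_pre_digraph \<Rightarrow> bool" where
  "algorithm_output G \<P> Aux \<longleftrightarrow>
    (\<exists>M s. perfect_matching G M \<and>
           while_loop G \<lparr> var_U = nodes G, var_f = (\<lambda>_. 0), var_A = {}, var_P = {} \<rparr> s \<and>
           \<P> = var_P s \<and> Aux = \<lparr> pverts = nodes G, parcs = var_A s \<rparr>)"

end

theory Submission
  imports Defs
begin

text \<open>
  Everything is expressed through the family of matchable vertex sets (those inducing a factorizable
  subgraph). It satisfies the symmetric exchange property of delta-matroids, which replaces all
  arguments with alternating paths.

  Write \<open>R(u) = D(G - u)\<close> and \<open>X(u) = A(G - u) \<union> {u}\<close>. Exchange gives \<open>R(x) \<subseteq> R(u)\<close> for \<open>x \<in> X(u)\<close>,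
  and Gallai's argument shows that the components \<open>K\<close> of \<open>G[R(u)]\<close> are factor-critical and that every
  perfect matching of \<open>G\<close> matches \<open>X(u)\<close> bijectively to them. By parity, all allowed edges leaving
  such a \<open>K\<close> end in a single factor-component. Hence the DM-component of \<open>x\<close> consists of the vertices
  of \<open>X(u)\<close> in the factor-component \<open>H(x)\<close> and the components \<open>K\<close> that meet \<open>H(x)\<close>, and the algorithm
  draws arcs from \<open>x\<close> to exactly the vertices of these \<open>K\<close>.

  Such an arc stays above \<open>H(x)\<close> in the order, since \<open>H(x) \<union> K\<close> is separating and contracting \<open>H(x)\<close>
  in it leaves a factor-critical graph. Conversely let \<open>Z\<close> witness that \<open>H\<close> is below the factor-component
  of \<open>y\<close>, where \<open>y\<close> is not in \<open>H\<close>. The component of \<open>G[Z - H]\<close> containing \<open>y\<close> is adjacent to some \<open>w \<in> H\<close>;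
  if \<open>x\<close> is the mate of \<open>w\<close> in a perfect matching, then \<open>X(x)\<close> meets \<open>Z\<close> only inside \<open>H\<close>, so that \<open>y\<close>
  lies in the same \<open>K\<close> as \<open>w\<close> and \<open>(x, y)\<close> is an arc.
\<close>

section \<open>Matchable sets\<close>

text \<open>A predicate on vertex sets, not on matchings: removal, restriction and exchange become
  rule inductions, and an actual matching is recovered only when the graph definitions ask for
  one.\<close>

inductive matchable :: "'a set set \<Rightarrow> 'a set \<Rightarrow> bool" for E where
  empty: "matchable E {}"
| insert: "matchable E A \<Longrightarrow> {a, b} \<in> E \<Longrightarrow> a \<noteq> b \<Longrightarrow> a \<notin> A \<Longrightarrow> b \<notin> A
    \<Longrightarrow> matchable E (insert a (insert b A))"

lemma matchable_finite: "matchable E A \<Longrightarrow> finite A"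
  by (induction rule: matchable.induct) auto

lemma matchable_even: "matchable E A \<Longrightarrow> even (card A)"
  by (induction rule: matchable.induct) (auto simp: matchable_finite)

lemma matchable_mono: "matchable E A \<Longrightarrow> E \<subseteq> E' \<Longrightarrow> matchable E' A"
  by (induction rule: matchable.induct) (auto intro: matchable.intros)

lemma matchable_addI:
  assumes "matchable E (A - {a, b})" "{a, b} \<in> E" "a \<noteq> b" "a \<in> A" "b \<in> A"
  shows "matchable E A"
proof -
  have "A = insert a (insert b (A - {a, b}))" using assms by auto
  then show ?thesis using matchable.insert[OF assms(1-3)] by (metis Diff_iff insertCI)
qed

text \<open>The edges of a matching can be added in any order, so any vertex of the set may be taken
  as an end of the edge added last.\<close>

lemma matchable_remove:
  assumes "matchable E A" "a \<in> A"
  obtains b where "b \<in> A" "b \<noteq> a" "{a, b} \<in> E" "matchable E (A - {a, b})"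
proof -
  have "\<exists>b. b \<in> A \<and> b \<noteq> a \<and> {a, b} \<in> E \<and> matchable E (A - {a, b})"
    using assms
  proof (induction rule: matchable.induct)
    case (insert A c d)
    consider "a = c" | "a = d" | "a \<in> A" "a \<noteq> c" "a \<noteq> d" using insert by auto
    then show ?case
    proof cases
      case 1
      have "insert c (insert d A) - {c, d} = A" using insert by auto
      then show ?thesis using 1 insert by (intro exI[of _ d]) auto
    next
      case 2
      have "insert c (insert d A) - {d, c} = A" using insert by auto
      then show ?thesis using 2 insert by (intro exI[of _ c]) (auto simp: insert_commute)
    next
      case 3
      then obtain b where b: "b \<in> A" "b \<noteq> a" "{a, b} \<in> E" "matchable E (A - {a, b})"
        using insert by auto
      have "insert c (insert d A) - {a, b} = insert c (insert d (A - {a, b}))"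
        using 3 b insert by auto
      then show ?thesis using b insert 3
        by (intro exI[of _ b]) (auto intro!: matchable.insert)
    qed
  qed auto
  then show ?thesis using that by blast
qed

lemma matchable_Un:
  assumes "matchable E A" "matchable E B" "A \<inter> B = {}"
  shows "matchable E (A \<union> B)"
  using assms by (induction rule: matchable.induct) (auto intro!: matchable.insert)

text \<open>Every edge used to build \<open>A\<close> belongs to a perfect matching of
  \<open>A\<close>. An earlier edge keeps this property when \<open>{a, b}\<close> is added, because
  \<open>{a, b}\<close> can also be added to the matching that avoids it.\<close>

lemma matchable_allowed:
  "matchable E A \<Longrightarrow> matchable {e \<in> E. e \<subseteq> A \<and> matchable E (A - e)} A"
proof (induction rule: matchable.induct)
  case (insert A a b)
  let ?A = "insert a (insert b A)"
  have "{e \<in> E. e \<subseteq> A \<and> matchable E (A - e)} \<subseteq> {e \<in> E. e \<subseteq> ?A \<and> matchable E (?A - e)}"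
  proof safe
    fix e assume "e \<in> E" "e \<subseteq> A" "matchable E (A - e)"
    moreover have "?A - e = insert a (insert b (A - e))" using insert \<open>e \<subseteq> A\<close> by auto
    ultimately show "matchable E (?A - e)" using insert by (auto intro!: matchable.insert)
  qed auto
  moreover have "?A - {a, b} = A" using insert by auto
  ultimately show ?case using insert
    by (intro matchable.insert matchable_mono[OF insert.IH]) auto
qed (auto intro: matchable.intros)

lemma matchable_restrict:
  assumes "matchable E A" "\<And>a b. a \<in> A \<inter> T \<Longrightarrow> b \<in> A - T \<Longrightarrow> {a, b} \<notin> E"
  shows "matchable E (A \<inter> T)"
  using assms
proof (induction rule: matchable.induct)
  case (insert A a b)
  have "matchable E (A \<inter> T)" using insert by auto
  moreover have "a \<in> T \<longleftrightarrow> b \<in> T"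
    using insert.prems[of a b] insert.prems[of b a] insert.hyps by (auto simp: insert_commute)
  ultimately show ?case using insert.hyps
    by (cases "a \<in> T") (auto intro!: matchable.insert)
qed (auto intro: matchable.intros)

text \<open>A perfect matching of \<open>A\<close> uses only allowed edges of \<open>A\<close>. If
  none of them leaves \<open>T\<close>, the matching splits along \<open>T\<close>. This is the
  standard way below to show that a set is matchable.\<close>

lemma matchable_closed:
  assumes "matchable E A" "T \<subseteq> A"
    "\<And>a b. a \<in> T \<Longrightarrow> b \<in> A - T \<Longrightarrow> {a, b} \<in> E \<Longrightarrow> \<not> matchable E (A - {a, b})"
  shows "matchable E T"
proof -
  have "matchable {e \<in> E. e \<subseteq> A \<and> matchable E (A - e)} (A \<inter> T)"
    using assms by (intro matchable_restrict matchable_allowed) auto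
  moreover have "A \<inter> T = T" using assms by auto
  ultimately show ?thesis using matchable_mono by (metis (lifting) mem_Collect_eq subsetI)
qed

section \<open>Perfect matchings as fixed-point-free involutions\<close>

lemma matchable_mate:
  assumes "matchable E A"
  obtains m where "\<And>a. a \<in> A \<Longrightarrow> m a \<in> A" "\<And>a. a \<in> A \<Longrightarrow> m a \<noteq> a"
    "\<And>a. a \<in> A \<Longrightarrow> m (m a) = a" "\<And>a. a \<in> A \<Longrightarrow> {a, m a} \<in> E"
proof -
  have "\<exists>m. \<forall>a\<in>A. m a \<in> A \<and> m a \<noteq> a \<and> m (m a) = a \<and> {a, m a} \<in> E"
    using assms
  proof (induction rule: matchable.induct)
    case (insert A a b)
    then obtain m where "\<forall>a\<in>A. m a \<in> A \<and> m a \<noteq> a \<and> m (m a) = a \<and> {a, m a} \<in> E" by auto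
    then show ?case using insert.hyps
      by (intro exI[of _ "m(a := b, b := a)"]) (auto simp: insert_commute)
  qed auto
  then show ?thesis using that by blast
qed

lemma matchable_if_mate:
  assumes "finite A" "\<And>a. a \<in> A \<Longrightarrow> m a \<in> A \<and> m a \<noteq> a \<and> m (m a) = a \<and> {a, m a} \<in> E"
  shows "matchable E A"
  using assms
proof (induction A rule: finite_psubset_induct)
  case (psubset A)
  show ?case
  proof (cases "A = {}")
    case False
    then obtain a where a: "a \<in> A" by auto
    have "matchable E (A - {a, m a})"
    proof (rule psubset.IH)
      show "A - {a, m a} \<subset> A" using a by auto
      show "m b \<in> A - {a, m a} \<and> m b \<noteq> b \<and> m (m b) = b \<and> {b, m b} \<in> E"
        if "b \<in> A - {a, m a}" for b
        using psubset.prems[of b] psubset.prems[of a] that a by auto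
    qed
    then show ?thesis using psubset.prems[OF a] a by (intro matchable_addI[of E A a "m a"]) auto
  qed (auto intro: matchable.intros)
qed

text \<open>
  The induction follows the alternating path \<open>a, a', a'', \<dots>\<close> two steps at a time, deleting the edges used.
\<close>

lemma matchable_exchange_aux:
  assumes "matchable E A" "matchable E B" "a \<in> A - B"
  shows "\<exists>b\<in>sym_diff A B. b \<noteq> a \<and> matchable E (sym_diff A {a, b}) \<and> matchable E (sym_diff B {a, b})"
  using assms
proof (induction "card A" arbitrary: A B a rule: less_induct)
  case less
  obtain a' where a': "a' \<in> A" "a' \<noteq> a" "{a, a'} \<in> E" "matchable E (A - {a, a'})"
    using matchable_remove[OF less.prems(1), of a] less.prems(3) by auto
  show ?case
  proof (cases "a' \<in> B")
    case False
    have "sym_diff A {a, a'} = A - {a, a'}" "sym_diff B {a, a'} = insert a (insert a' B)"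
      using False a' less.prems by auto
    then show ?thesis using a' False less.prems
      by (intro bexI[of _ a']) (auto intro!: matchable.insert)
  next
    case True
    obtain a'' where a'': "a'' \<in> B" "a'' \<noteq> a'" "{a', a''} \<in> E" "matchable E (B - {a', a''})"
      using matchable_remove[OF less.prems(2) True] by auto
    have ne: "a'' \<noteq> a" using a'' less.prems by auto
    show ?thesis
    proof (cases "a'' \<in> A")
      case False
      have "sym_diff A {a, a''} = insert a' (insert a'' (A - {a, a'}))"
        "sym_diff B {a, a''} = insert a (insert a' (B - {a', a''}))"
        using False True a' a'' ne less.prems by auto
      then show ?thesis using a' a'' ne False True less.prems
        by (intro bexI[of _ a'']) (auto intro!: matchable.insert)
    next
      \<comment> \<open>After deleting \<open>{a, a'}\<close> from \<open>A\<close> and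
        \<open>{a', a''}\<close> from \<open>B\<close>, the vertex \<open>a''\<close> lies only in
        the first set, so it takes over the role of \<open>a\<close>. The deleted edges then swap
        sides: \<open>A\<close> receives \<open>{a', a''}\<close> and \<open>B\<close> receives
        \<open>{a, a'}\<close>.\<close>
      case aA: True
      have "card (A - {a, a'}) < card A"
        using less.prems matchable_finite[OF less.prems(1)] by (intro psubset_card_mono) auto
      then obtain b where b: "b \<in> sym_diff (A - {a, a'}) (B - {a', a''})" "b \<noteq> a''"
        "matchable E (sym_diff (A - {a, a'}) {a'', b})"
        "matchable E (sym_diff (B - {a', a''}) {a'', b})"
        using less.hyps[of "A - {a, a'}" "B - {a', a''}" a''] a' a'' aA ne by auto
      have "sym_diff A {a, b} = insert a' (insert a'' (sym_diff (A - {a, a'}) {a'', b}))"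
        "sym_diff B {a, b} = insert a (insert a' (sym_diff (B - {a', a''}) {a'', b}))"
        using b a' a'' aA ne True less.prems by auto
      moreover have "matchable E (insert a' (insert a'' (sym_diff (A - {a, a'}) {a'', b})))"
        using b a' a'' aA ne True less.prems by (intro matchable.insert) auto
      moreover have "matchable E (insert a (insert a' (sym_diff (B - {a', a''}) {a'', b})))"
        using b a' a'' aA ne True less.prems by (intro matchable.insert) auto
      ultimately show ?thesis using b less.prems by (intro bexI[of _ b]) auto
    qed
  qed
qed

text \<open>Typical use: the two sets differ in a few vertices or in a controlled part, so that the
  candidates for \<open>b\<close> can be listed or located.\<close>

lemma matchable_exchange:
  assumes "matchable E A" "matchable E B" "a \<in> sym_diff A B"
  obtains b where "b \<in> sym_diff A B" "b \<noteq> a"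
    "matchable E (sym_diff A {a, b})" "matchable E (sym_diff B {a, b})"
  using matchable_exchange_aux[OF assms(1,2), of a] matchable_exchange_aux[OF assms(2,1), of a]
    assms(3) by blast

section \<open>Connected components\<close>

definition adjacency :: "'a set set \<Rightarrow> 'a set \<Rightarrow> ('a \<times> 'a) set" where
  "adjacency E W = {(a, b). a \<in> W \<and> b \<in> W \<and> {a, b} \<in> E}"

text \<open>\<open>W\<close> restricts the edges but not the starting vertex: for
  \<open>x \<notin> W\<close> the result is \<open>{x}\<close>. Hence \<open>component_self\<close>
  and \<open>component_eq\<close> hold without side conditions.\<close>

definition component :: "'a set set \<Rightarrow> 'a set \<Rightarrow> 'a \<Rightarrow> 'a set" where
  "component E W x = (adjacency E W)\<^sup>* `` {x}"

lemma component_self [simp]: "x \<in> component E W x"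
  by (auto simp: component_def)

lemma sym_adjacency: "sym (adjacency E W)"
  by (auto simp: sym_def adjacency_def insert_commute)

lemma component_step:
  "a \<in> component E W x \<Longrightarrow> a \<in> W \<Longrightarrow> b \<in> W \<Longrightarrow> {a, b} \<in> E \<Longrightarrow> b \<in> component E W x"
  by (auto simp: component_def adjacency_def intro: rtrancl_into_rtrancl)

lemma component_induct [consumes 1, case_names base step]:
  assumes "y \<in> component E W x" "P x"
    "\<And>a b. a \<in> component E W x \<Longrightarrow> a \<in> W \<Longrightarrow> b \<in> W \<Longrightarrow> {a, b} \<in> E \<Longrightarrow> P a \<Longrightarrow> P b"
  shows "P y"
proof -
  have "(x, y) \<in> (adjacency E W)\<^sup>*" using assms(1) by (auto simp: component_def)
  then show ?thesis
  proof (induction rule: rtrancl_induct)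
    case (step a b)
    then show ?case using assms(3)[of a b] by (auto simp: component_def adjacency_def)
  qed (use assms in auto)
qed

lemma component_subset: "x \<in> W \<Longrightarrow> component E W x \<subseteq> W"
  by (auto elim: component_induct)

lemma component_eq: "y \<in> component E W x \<Longrightarrow> component E W y = component E W x"
  using sym_rtrancl[OF sym_adjacency, of E W] unfolding component_def
  by (auto dest: symD intro: rtrancl_trans)

lemma component_sym: "y \<in> component E W x \<Longrightarrow> x \<in> component E W y"
  by (metis component_eq component_self)

lemma component_mono: "W \<subseteq> W' \<Longrightarrow> component E W x \<subseteq> component E W' x"
  unfolding component_def by (intro Image_mono rtrancl_mono) (auto simp: adjacency_def)

lemma component_leave:
  assumes "y \<in> component E W x" "x \<in> T" "y \<notin> T"
  obtains a b where "a \<in> component E W x" "b \<in> component E W x" "a \<in> W" "b \<in> W"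
    "{a, b} \<in> E" "a \<in> T" "b \<notin> T"
proof -
  have "y \<in> T \<or> (\<exists>a b. a \<in> component E W x \<and> b \<in> component E W x \<and> a \<in> W \<and> b \<in> W
    \<and> {a, b} \<in> E \<and> a \<in> T \<and> b \<notin> T)"
    using assms(1)
  proof (induction rule: component_induct)
    case (step a b)
    then show ?case using component_step[OF step.hyps(1-4)] by blast
  qed (use assms in auto)
  then show ?thesis using that assms(3) by blast
qed

section \<open>Barriers and factor-components\<close>

text \<open>The combinatorial core speaks of bare edge and vertex sets;
  \<open>factorizable_graph\<close> connects it to the record \<open>ugraph\<close>.\<close>

locale matchable_graph =
  fixes E :: "'a set set" and V :: "'a set"
  assumes edge_card: "e \<in> E \<Longrightarrow> e \<subseteq> V \<and> card e = 2"
    and matchable_V: "matchable E V"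
begin

abbreviation F :: "'a set \<Rightarrow> bool" where
  "F \<equiv> matchable E"

text \<open>
  \<open>R u\<close> is \<open>D(G - u)\<close>, \<open>X u\<close> is \<open>A(G - u) \<union> {u}\<close>, \<open>H x\<close> is the vertex set of the factor-component of
  \<open>x\<close>, and \<open>K u k\<close> is the component of \<open>G[R u]\<close> containing \<open>k\<close>.
\<close>

definition R :: "'a \<Rightarrow> 'a set" where
  "R u = {v \<in> V - {u}. F (V - {u, v})}"

definition X :: "'a \<Rightarrow> 'a set" where
  "X u = insert u {v \<in> V - R u. \<exists>r\<in>R u. {r, v} \<in> E}"

definition allowed_edges :: "'a set set" where
  "allowed_edges = {e \<in> E. F (V - e)}"

definition H :: "'a \<Rightarrow> 'a set" where
  "H x = component allowed_edges V x"

abbreviation K :: "'a \<Rightarrow> 'a \<Rightarrow> 'a set" where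
  "K u k \<equiv> component E (R u) k"

section \<open>Elementary facts on \<open>R\<close> and \<open>X\<close>, and the nesting of the
  sets \<open>R\<close>\<close>

lemma finite_V: "finite V"
  using matchable_V by (rule matchable_finite)

lemma edgeD: "{a, b} \<in> E \<Longrightarrow> a \<in> V \<and> b \<in> V \<and> a \<noteq> b"
  using edge_card[of "{a, b}"] by auto

lemma edge_sym: "{a, b} \<in> E \<longleftrightarrow> {b, a} \<in> E"
  by (simp add: insert_commute)

lemma in_R_iff: "v \<in> R u \<longleftrightarrow> v \<in> V \<and> v \<noteq> u \<and> F (V - {u, v})"
  by (auto simp: R_def)

lemma R_sym: "u \<in> V \<Longrightarrow> v \<in> R u \<Longrightarrow> u \<in> R v"
  by (auto simp: in_R_iff insert_commute)

lemma R_subset_V: "R u \<subseteq> V"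
  by (auto simp: R_def)

lemma not_self_R [simp]: "u \<notin> R u"
  by (auto simp: R_def)

lemma self_X [simp]: "u \<in> X u"
  by (auto simp: X_def)

lemma X_subset_V: "u \<in> V \<Longrightarrow> X u \<subseteq> V"
  by (auto simp: X_def)

lemma X_R_disjoint: "x \<in> X u \<Longrightarrow> x \<notin> R u"
  by (auto simp: X_def)

lemma R_neighbour: "a \<in> R u \<Longrightarrow> {a, b} \<in> E \<Longrightarrow> b \<notin> X u \<Longrightarrow> b \<in> R u"
  using edgeD[of a b] by (auto simp: X_def)

text \<open>Let \<open>v \<in> R x - R u\<close> and let \<open>r \<in> R u\<close> be adjacent to
  \<open>x\<close>. Exchanging \<open>x\<close> between \<open>V - {u, r}\<close> and
  \<open>V - {x, v}\<close> leaves the partners \<open>u\<close>, \<open>r\<close> and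
  \<open>v\<close>. The first and the third put \<open>v\<close> into \<open>R u\<close>, the third
  after adding the edge \<open>{r, x}\<close>; the second puts \<open>x\<close> into
  \<open>R u\<close>.\<close>

lemma R_subset_R:
  assumes "u \<in> V" "x \<in> X u"
  shows "R x \<subseteq> R u"
proof
  fix v assume v: "v \<in> R x"
  show "v \<in> R u"
  proof (rule ccontr)
    assume nv: "v \<notin> R u"
    have xu: "x \<noteq> u" using v nv by auto
    obtain r where r: "r \<in> R u" "{r, x} \<in> E" "x \<notin> R u" "x \<in> V"
      using assms xu by (auto simp: X_def)
    have d: "u \<noteq> v" "r \<noteq> v" "r \<noteq> x" "u \<noteq> r" "x \<noteq> v" "v \<in> V" "r \<in> V"
      using v nv r R_sym[of x v] by (auto simp: in_R_iff)
    let ?A = "V - {u, r}" and ?B = "V - {x, v}"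
    have "F ?A" "F ?B" using r v by (auto simp: in_R_iff)
    moreover have "x \<in> sym_diff ?A ?B" using xu d r by auto
    ultimately obtain b where b: "b \<in> sym_diff ?A ?B" "b \<noteq> x" "F (sym_diff ?A {x, b})"
      "F (sym_diff ?B {x, b})"
      by (rule matchable_exchange)
    consider "b = u" | "b = r" | "b = v" using b by auto
    then show False
    proof cases
      case 1
      have "sym_diff ?B {x, b} = V - {u, v}" using 1 assms d r xu by auto
      then show ?thesis using b nv d by (auto simp: in_R_iff)
    next
      case 2
      have "sym_diff ?A {x, b} = V - {u, x}" using 2 assms d r xu by auto
      then show ?thesis using b r xu by (auto simp: in_R_iff)
    next
      case 3
      have "sym_diff ?A {x, b} = V - {u, v} - {r, x}" using 3 assms d r xu by auto
      then have "F (V - {u, v} - {r, x})" using b(3) by simp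
      then have "F (V - {u, v})" by (rule matchable_addI) (use r d xu in auto)
      then show ?thesis using nv d by (auto simp: in_R_iff)
    qed
  qed
qed

text \<open>A walk in \<open>G[R u]\<close> that leaves \<open>R z\<close> enters some
  \<open>b \<in> X z\<close>. By nesting \<open>R b \<subseteq> R z \<subseteq> R u\<close>, while
  \<open>b \<in> R u\<close> gives \<open>u \<in> R b\<close> by symmetry, so that
  \<open>u \<in> R u\<close>, which is impossible.\<close>

lemma K_subset_R:
  assumes "u \<in> V" "z \<in> X u" "n \<in> R z"
  shows "K u n \<subseteq> R z"
proof
  fix t assume "t \<in> K u n"
  then show "t \<in> R z"
  proof (induction rule: component_induct)
    case (step a b)
    show ?case
    proof (rule ccontr)
      assume "b \<notin> R z"
      then have "b \<in> X z" using R_neighbour step by blast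
      moreover have "z \<in> V" using assms X_subset_V by auto
      ultimately have "R b \<subseteq> R u" using R_subset_R assms by blast
      then show False using R_sym[of u b] step assms by auto
    qed
  qed (use assms in auto)
qed

text \<open>
  Gallai's lemma: for \<open>t\<close> in the component, ``\<open>G - z - z'\<close> has no perfect matching after deleting \<open>n\<close>
  and \<open>t\<close>'' propagates along edges, because by exchange this is a transitive relation.
\<close>

lemma gallai:
  assumes z: "z \<in> V" "z' \<in> V" "z \<noteq> z'" and nF: "\<not> F (V - {z, z'})"
    and sub: "component E W n \<subseteq> R z - {z'}" and n': "n' \<in> component E W n" "n' \<noteq> n"
  shows "\<not> F (V - {z, z', n, n'})"
proof -
  have adj: "\<not> F (V - {z, z', a, b})"
    if "{a, b} \<in> E" "a \<in> component E W n" "b \<in> component E W n" for a b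
  proof
    assume f: "F (V - {z, z', a, b})"
    have eq: "V - {z, z', a, b} = V - {z, z'} - {a, b}" by blast
    have "a \<in> R z - {z'}" "b \<in> R z - {z'}" using that(2,3) sub by blast+
    then have "a \<noteq> z" "b \<noteq> z" "a \<noteq> z'" "b \<noteq> z'" using not_self_R[of z] by blast+
    then have "a \<in> V - {z, z'}" "b \<in> V - {z, z'}" "a \<noteq> b" using edgeD[OF that(1)] by auto
    then have "F (V - {z, z'})" using matchable_addI[OF f[unfolded eq] that(1)] by simp
    then show False using nF by simp
  qed
  have "n' = n \<or> \<not> F (V - {z, z', n, n'})"
    using n'(1)
  proof (induction rule: component_induct)
    case (step a b)
    note bC = component_step[OF step.hyps]
    have ab: "a \<in> R z" "b \<in> R z" "a \<noteq> z'" "b \<noteq> z'" "a \<noteq> b" "a \<noteq> z" "b \<noteq> z" "a \<in> V" "b \<in> V"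
      using subsetD[OF sub bC] subsetD[OF sub step.hyps(1)] edgeD[OF step.hyps(4)] not_self_R[of z]
      by auto
    have nR: "n \<in> R z" "n \<noteq> z'" "n \<noteq> z" "n \<in> V"
      using subsetD[OF sub component_self] not_self_R[of z] R_subset_V by auto
    show ?case
    proof (rule ccontr)
      assume "\<not> ?case"
      then have bn: "b \<noteq> n" "F (V - {z, z', n, b})" by auto
      show False
      proof (cases "a = n")
        case True
        then show False using adj[of n b] bn step.hyps bC by auto
      next
        case False
        \<comment> \<open>A perfect matching of \<open>G - z - a\<close> loses its edge at
          \<open>z'\<close>, whose other end is \<open>y\<close>. The resulting set misses
          \<open>a\<close> and is exchanged at \<open>a\<close> with the supposed one that misses
          \<open>n\<close> and \<open>b\<close>; every partner contradicts \<open>nab\<close>,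
          \<open>nan\<close> or \<open>nF\<close>.\<close>
        have "F (V - {z, a})" using ab by (simp add: in_R_iff)
        then obtain y where y: "y \<in> V - {z, a}" "y \<noteq> z'" "{z', y} \<in> E" "F (V - {z, a} - {z', y})"
          using matchable_remove[of E "V - {z, a}" z'] z ab by auto
        let ?A = "V - {z, z', n, b}" and ?B = "V - {z, z', a, y}"
        have "V - {z, a} - {z', y} = ?B" by auto
        then have FB: "F ?B" using y by simp
        have nan: "\<not> F (V - {z, z', n, a})" using step.IH False by simp
        have nab: "\<not> F (V - {z, z', a, b})" using adj bC step.hyps by auto
        have "a \<in> sym_diff ?A ?B" using False ab by auto
        from matchable_exchange[OF bn(2) FB this] obtain c where
          c: "c \<in> sym_diff ?A ?B" "c \<noteq> a" "F (sym_diff ?A {a, c})" "F (sym_diff ?B {a, c})"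
          by blast
        have yn: "y \<noteq> n" "y \<noteq> b" using FB nan nab by (auto simp: insert_commute)
        consider "c = n" | "c = b" | "c = y" using c by auto
        then show False
        proof cases
          case 1
          have "sym_diff ?A {a, c} = V - {z, z', a, b}" using 1 ab nR False bn z by auto
          then show False using c nab by simp
        next
          case 2
          have "sym_diff ?A {a, c} = V - {z, z', n, a}" using 2 ab nR False bn z by auto
          then show False using c nan by simp
        next
          case 3
          have "sym_diff ?B {a, c} = V - {z, z'}" using 3 ab y z by auto
          then show False using c nF by simp
        qed
      qed
    qed
  qed simp
  then show ?thesis using n' by blast
qed

text \<open>Otherwise \<open>z' \<in> R z \<subseteq> R u\<close>, but \<open>X u\<close> and
  \<open>R u\<close> are disjoint. This is the barrier property of \<open>X u\<close>.\<close>

lemma X_pair: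
  assumes "u \<in> V" "z \<in> X u" "z' \<in> X u" "z \<noteq> z'"
  shows "\<not> F (V - {z, z'})"
proof
  assume "F (V - {z, z'})"
  then have "z' \<in> R z" using assms X_subset_V by (auto simp: in_R_iff)
  then show False using R_subset_R[OF assms(1,2)] X_R_disjoint[OF assms(3)] by auto
qed

section \<open>Factor-criticality of the components of \<open>G[R u]\<close>\<close>

lemma K_subset: "k \<in> R u \<Longrightarrow> K u k \<subseteq> R u"
  by (rule component_subset)

text \<open>Prevents a matching from joining one component to two barrier vertices: deleting both
  edges would leave the set excluded here. Gallai's lemma applies because \<open>K u n\<close> lies
  in \<open>R z\<close> and misses \<open>z'\<close>.\<close>

lemma two_exits:
  assumes "u \<in> V" "z \<in> X u" "z' \<in> X u" "z \<noteq> z'" "n \<in> R u" "n' \<in> K u n" "n \<noteq> n'" "n \<in> R z"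
  shows "\<not> F (V - {z, z', n, n'})"
proof (rule gallai[where W = "R u"])
  show "K u n \<subseteq> R z - {z'}"
    using K_subset_R[OF assms(1,2,8)] K_subset[OF assms(5)] X_R_disjoint[OF assms(3)] by auto
qed (use assms X_pair[OF assms(1-4)] X_subset_V[OF assms(1)] in auto)

lemma K_step: "a \<in> K u k \<Longrightarrow> k \<in> R u \<Longrightarrow> {a, b} \<in> E \<Longrightarrow> b \<notin> X u \<Longrightarrow> b \<in> K u k"
  using K_subset[of k u] R_neighbour[of a u b] component_step[of a E "R u" k b] by auto

text \<open>Take a perfect matching of \<open>G - u - k\<close>. An edge of it leaving
  \<open>K u k - {k}\<close> would end in some \<open>b \<in> X u\<close> other than
  \<open>u\<close>; without this edge, the matching contradicts \<open>two_exits\<close> for the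
  barrier vertices \<open>u\<close> and \<open>b\<close>.\<close>

lemma factor_critical_K:
  assumes "u \<in> V" "k \<in> R u"
  shows "F (K u k - {k})"
proof (rule matchable_closed)
  show "F (V - {u, k})" using assms by (simp add: in_R_iff)
  show "K u k - {k} \<subseteq> V - {u, k}" using K_subset[OF assms(2)] R_subset_V not_self_R[of u] by auto
  fix a b assume a: "a \<in> K u k - {k}" and b: "b \<in> V - {u, k} - (K u k - {k})" and ab: "{a, b} \<in> E"
  have "b \<in> X u" using K_step[of a u k b] a b ab assms by auto
  then have "\<not> F (V - {u, b, k, a})"
    using two_exits[of u u b k a] a b assms by auto
  moreover have "V - {u, k} - {a, b} = V - {u, b, k, a}" by auto
  ultimately show "\<not> F (V - {u, k} - {a, b})" by simp
qed

lemma factor_critical_K_at: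
  assumes "u \<in> V" "k \<in> R u" "n \<in> K u k"
  shows "F (K u k - {n})"
  using factor_critical_K[OF assms(1), of n] component_eq[OF assms(3)] K_subset[OF assms(2)] assms(3)
  by auto

lemma finite_K: "k \<in> R u \<Longrightarrow> finite (K u k)"
  using K_subset[of k u] R_subset_V[of u] finite_V by (meson finite_subset)

lemma odd_K:
  assumes "u \<in> V" "k \<in> R u"
  shows "odd (card (K u k))"
proof -
  have "card (K u k) = Suc (card (K u k - {k}))"
    using finite_K[OF assms(2)] by (subst card_Suc_Diff1) auto
  then show ?thesis using matchable_even[OF factor_critical_K[OF assms]] by simp
qed

section \<open>Allowed edges between the barrier and the components\<close>

lemma allowedD: "{a, b} \<in> allowed_edges \<Longrightarrow> {a, b} \<in> E \<and> a \<in> V \<and> b \<in> V \<and> a \<noteq> b \<and> b \<in> R a \<and> a \<in> R b"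
  using edgeD[of a b] by (auto simp: allowed_edges_def in_R_iff insert_commute)

lemma allowedI: "{a, b} \<in> E \<Longrightarrow> b \<in> R a \<Longrightarrow> {a, b} \<in> allowed_edges"
  by (auto simp: allowed_edges_def in_R_iff)

lemma allowed_sym: "{a, b} \<in> allowed_edges \<longleftrightarrow> {b, a} \<in> allowed_edges"
  by (simp add: insert_commute)

lemma H_self [simp]: "x \<in> H x"
  by (simp add: H_def)

lemma H_subset_V: "x \<in> V \<Longrightarrow> H x \<subseteq> V"
  unfolding H_def by (rule component_subset)

lemma H_eq: "y \<in> H x \<Longrightarrow> H y = H x"
  unfolding H_def by (rule component_eq)

lemma H_step: "a \<in> H x \<Longrightarrow> {a, b} \<in> allowed_edges \<Longrightarrow> b \<in> H x"
  unfolding H_def using allowedD by (blast intro: component_step)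

lemma H_leave:
  assumes "y \<in> H x" "x \<in> T" "y \<notin> T"
  obtains a b where "a \<in> H x" "b \<in> H x" "{a, b} \<in> allowed_edges" "a \<in> T" "b \<notin> T"
  using component_leave[OF assms(1)[unfolded H_def] assms(2,3)] unfolding H_def by metis

text \<open>The other end lies in \<open>R a\<close>, and \<open>R a \<subseteq> R u\<close> by
  nesting.\<close>

lemma allowed_X: "u \<in> V \<Longrightarrow> a \<in> X u \<Longrightarrow> {a, b} \<in> allowed_edges \<Longrightarrow> b \<in> R u"
  using allowedD R_subset_R by blast

lemma H_subset_X_R:
  assumes "u \<in> V" "x \<in> X u"
  shows "H x \<subseteq> X u \<union> R u"
proof
  fix y assume "y \<in> H x"
  then show "y \<in> X u \<union> R u" unfolding H_def
  proof (induction rule: component_induct)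
    case (step a b)
    then show ?case using allowed_X[OF assms(1)] R_neighbour[of a u b] allowedD[of a b] by blast
  qed (use assms in auto)
qed

text \<open>Nesting holds in both directions: \<open>x \<in> H s\<close> lies in
  \<open>X s \<union> R s\<close>, and not in \<open>R s\<close>, because
  \<open>R s \<subseteq> R x\<close>.\<close>

lemma R_eq:
  assumes "x \<in> V" "s \<in> X x" "s \<in> H x"
  shows "R s = R x"
proof
  show *: "R s \<subseteq> R x" using R_subset_R assms by auto
  have sV: "s \<in> V" using assms X_subset_V by auto
  have "x \<in> H s" using H_eq[OF assms(3)] by simp
  then have "x \<in> X s" using H_subset_X_R[OF sV, of s] * by auto
  then show "R x \<subseteq> R s" using R_subset_R sV by auto
qed

text \<open>
  A perfect matching through an allowed edge \<open>zk\<close> leaves the component of \<open>k\<close> only along \<open>zk\<close>, hence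
  matches the rest of every factor-component inside it.
\<close>

lemma exit_parity:
  assumes "u \<in> V" "z \<in> X u" "{z, k} \<in> allowed_edges"
  shows "even (card (H h \<inter> K u k - {k}))"
proof -
  have k: "k \<in> R u" using assms allowed_X by blast
  note zk = allowedD[OF assms(3)]
  have Ksub: "K u k \<subseteq> R u" using K_subset k by auto
  have "F (H h \<inter> K u k - {k})"
  proof (rule matchable_closed)
    show "F (V - {z, k})" using assms(3) by (simp add: allowed_edges_def)
    show "H h \<inter> K u k - {k} \<subseteq> V - {z, k}"
      using Ksub R_subset_V X_R_disjoint[OF assms(2)] by auto
    fix a b assume a: "a \<in> H h \<inter> K u k - {k}" and b: "b \<in> V - {z, k} - (H h \<inter> K u k - {k})"
      and ab: "{a, b} \<in> E"
    show "\<not> F (V - {z, k} - {a, b})"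
    proof
      assume f: "F (V - {z, k} - {a, b})"
      have aV: "a \<noteq> z" "a \<noteq> k" using a Ksub X_R_disjoint[OF assms(2)] by auto
      \<comment> \<open>Putting \<open>{z, k}\<close> back shows that \<open>{a, b}\<close> is
        allowed in \<open>G\<close>, so \<open>b\<close> stays in \<open>H h\<close>. The edge
        therefore leaves the component, and \<open>b\<close> is a second barrier vertex next to
        \<open>z\<close>.\<close>
      have eq: "V - {z, k} - {a, b} = V - {a, b} - {z, k}" by blast
      have "z \<in> V - {a, b}" "k \<in> V - {a, b}" using aV b zk by auto
      then have "F (V - {a, b})" using matchable_addI[OF f[unfolded eq]] zk by blast
      then have "{a, b} \<in> allowed_edges" using ab by (simp add: allowed_edges_def)
      then have "b \<in> H h" using a H_step by blast
      then have "b \<in> X u" using K_step[of a u k b] a b ab k by auto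
      then have "\<not> F (V - {z, b, k, a})" using two_exits[of u z b k a] a b assms k zk by auto
      moreover have "V - {z, k} - {a, b} = V - {z, b, k, a}" by auto
      ultimately show False using f by simp
    qed
  qed
  then show ?thesis by (rule matchable_even)
qed

text \<open>If \<open>k' \<notin> H k\<close>, then \<open>exit_parity\<close> at \<open>k'\<close>
  removes nothing from \<open>H k \<inter> K u k\<close>, and at \<open>k\<close> it removes one
  vertex; both results cannot be even.\<close>

lemma exits_same_H:
  assumes "u \<in> V" "z \<in> X u" "{z, k} \<in> allowed_edges"
    "z' \<in> X u" "{z', k'} \<in> allowed_edges" "k' \<in> K u k"
  shows "H k' = H k"
proof (rule ccontr)
  assume "H k' \<noteq> H k"
  then have "k' \<notin> H k" using H_eq by blast
  then have even: "even (card (H k \<inter> K u k))"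
    using exit_parity[OF assms(1,4,5), of k] component_eq[OF assms(6)] by simp
  have even': "even (card (H k \<inter> K u k - {k}))" using exit_parity assms by blast
  have "finite (H k \<inter> K u k)"
    using finite_subset[OF H_subset_V finite_V, of k] allowedD[OF assms(3)] by auto
  then have "card (H k \<inter> K u k) = Suc (card (H k \<inter> K u k - {k}))"
    by (subst card_Suc_Diff1) auto
  with even even' show False by (metis even_Suc)
qed

lemma exit_exists:
  assumes "u \<in> V" "k \<in> R u" "k \<in> H x" "x \<in> X u"
  obtains z n where "z \<in> X u" "z \<in> H x" "n \<in> K u k" "n \<in> H x" "{z, n} \<in> allowed_edges"
proof -
  have "x \<in> H k" using H_eq[OF assms(3)] by simp
  moreover have "x \<notin> K u k" using K_subset[OF assms(2)] X_R_disjoint[OF assms(4)] by auto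
  ultimately obtain a b where ab: "a \<in> H k" "b \<in> H k" "{a, b} \<in> allowed_edges" "a \<in> K u k" "b \<notin> K u k"
    using H_leave[OF _ component_self] by metis
  then have "b \<in> X u" using K_step[of a u k b] allowedD[of a b] assms by blast
  then show ?thesis using that[of b a] ab H_eq[OF assms(3)] by (auto simp: allowed_sym)
qed

text \<open>Otherwise allowed edges of both \<open>H x\<close> and \<open>H y\<close> leave the
  component, and \<open>exits_same_H\<close> identifies the two factor-components.\<close>

lemma H_inside_K:
  assumes "u \<in> V" "k \<in> R u" "k \<in> H x" "x \<in> X u" "y \<in> K u k" "y \<notin> H x"
  shows "H y \<subseteq> K u k"
proof (rule ccontr)
  assume "\<not> H y \<subseteq> K u k"
  then obtain t where "t \<in> H y" "t \<notin> K u k" by auto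
  then obtain a b where ab: "a \<in> H y" "{a, b} \<in> allowed_edges" "a \<in> K u k" "b \<notin> K u k"
    using H_leave[OF _ assms(5)] by metis
  then have "b \<in> X u" using K_step[of a u k b] allowedD[of a b] assms by blast
  moreover obtain z n where zn: "z \<in> X u" "z \<in> H x" "n \<in> K u k" "n \<in> H x" "{z, n} \<in> allowed_edges"
    using exit_exists assms(1-4) by blast
  moreover have "a \<in> K u n" using component_eq[OF zn(3)] ab by simp
  ultimately have "H a = H n"
    using exits_same_H[of u z n b a] ab assms by (auto simp: allowed_sym)
  then have "H y = H x" using H_eq[OF ab(1)] H_eq[OF zn(4)] by simp
  then show False using assms(6) H_self by metis
qed

section \<open>The order on factor-components\<close>

definition separated :: "'a set \<Rightarrow> bool" where
  "separated Z \<longleftrightarrow> Z \<subseteq> V \<and> (\<forall>x\<in>Z. H x \<subseteq> Z)"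

text \<open>Factor-criticality of \<open>G[Z]\<close> with \<open>B\<close> contracted, lifted to
  \<open>G\<close>: \<open>w\<close> is the vertex of \<open>B\<close> at which the matching edge of
  the contracted vertex ends. The deletion of the contracted vertex itself is handled by
  \<open>separated_matchable\<close>.\<close>

definition critical_over :: "'a set \<Rightarrow> 'a set \<Rightarrow> bool" where
  "critical_over Z B \<longleftrightarrow> (\<forall>v\<in>Z - B. \<exists>w\<in>B. F (insert w (Z - B - {v})))"

text \<open>A relation on vertices that depends only on their factor-components, so that it can be
  compared directly with reachability between vertices.\<close>

definition below :: "'a \<Rightarrow> 'a \<Rightarrow> bool" where
  "below x y \<longleftrightarrow> (\<exists>Z. separated Z \<and> H x \<subseteq> Z \<and> H y \<subseteq> Z \<and> critical_over Z (H x))"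

lemma critical_overD:
  assumes "critical_over Z B" "v \<in> Z" "v \<notin> B"
  obtains w where "w \<in> B" "F (insert w (Z - B - {v}))"
  using assms unfolding critical_over_def by blast

lemma H_sym: "y \<in> H x \<Longrightarrow> x \<in> H y"
  using H_eq by simp

lemma separated_H: "x \<in> V \<Longrightarrow> separated (H x)"
  using H_subset_V H_eq by (auto simp: separated_def)

lemma separated_V: "separated V"
  using H_subset_V by (auto simp: separated_def)

lemma separated_Un: "separated Z \<Longrightarrow> separated Z' \<Longrightarrow> separated (Z \<union> Z')"
  by (auto simp: separated_def)

lemma separated_Diff: "separated Z \<Longrightarrow> separated Z' \<Longrightarrow> separated (Z - Z')"
  unfolding separated_def using H_sym by blast

text \<open>No allowed edge leaves a union of factor-components.\<close>

lemma separated_matchable: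
  assumes "separated Z"
  shows "F Z"
proof (rule matchable_closed[OF matchable_V])
  show "Z \<subseteq> V" using assms by (simp add: separated_def)
  fix a b assume *: "a \<in> Z" "b \<in> V - Z" "{a, b} \<in> E"
  show "\<not> F (V - {a, b})"
  proof
    assume "F (V - {a, b})"
    then have "b \<in> H a" using * H_step[OF H_self, of a b] by (simp add: allowed_edges_def)
    then show False using * assms by (auto simp: separated_def)
  qed
qed

text \<open>The sets \<open>K u k - H x\<close> (separated) and \<open>K u k - {v}\<close> (by
  factor-criticality) are both matchable. They differ in \<open>v\<close> and in
  \<open>K u k \<inter> H x\<close> only, so exchange at \<open>v\<close> returns the required
  vertex of \<open>H x\<close>.\<close>

lemma arc_below:
  assumes "u \<in> V" "x \<in> X u" "k \<in> R u" "k \<in> H x" "y \<in> K u k"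
  shows "below x y"
  unfolding below_def
proof (intro exI conjI)
  let ?Z = "H x \<union> K u k"
  have xV: "x \<in> V" using assms X_subset_V by auto
  have KV: "K u k \<subseteq> V" using K_subset[OF assms(3)] R_subset_V by blast
  show sep: "separated ?Z"
    unfolding separated_def
  proof (intro conjI ballI)
    show "?Z \<subseteq> V" using H_subset_V[OF xV] KV by blast
    fix t assume "t \<in> ?Z"
    then show "H t \<subseteq> ?Z"
      using H_eq[of t x] H_inside_K[OF assms(1,3,4,2), of t] by (cases "t \<in> H x") auto
  qed
  show "H x \<subseteq> ?Z" by simp
  show "H y \<subseteq> ?Z" using sep assms(5) by (auto simp: separated_def)
  show "critical_over ?Z (H x)"
    unfolding critical_over_def
  proof
    fix v assume v: "v \<in> ?Z - H x"
    have e: "?Z - H x = K u k - H x" by blast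
    have "F (K u k - H x)"
      using separated_matchable[OF separated_Diff[OF sep separated_H[OF xV]]] e by (simp only:)
    moreover have "F (K u k - {v})" using factor_critical_K_at[OF assms(1,3)] v by blast
    moreover have "v \<in> sym_diff (K u k - H x) (K u k - {v})" using v by blast
    ultimately obtain b where b: "b \<in> sym_diff (K u k - H x) (K u k - {v})" "b \<noteq> v"
      "F (sym_diff (K u k - H x) {v, b})"
      by (rule matchable_exchange)
    have bH: "b \<in> H x" "b \<in> K u k" using b(1,2) by auto
    have "sym_diff (K u k - H x) {v, b} = insert b (?Z - H x - {v})" using bH v by auto
    then show "\<exists>w\<in>H x. F (insert w (?Z - H x - {v}))" using b(3) bH by (metis (no_types))
  qed
qed

text \<open>The witness is \<open>Z \<union> Z'\<close>. A vertex deleted from \<open>Z\<close> is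
  treated in \<open>Z\<close> alone, with \<open>Z' - Z\<close> matched separately. A vertex deleted
  from \<open>Z' - Z\<close> is first traded for some \<open>b \<in> Z\<close>; unless
  \<open>b \<in> H x\<close>, criticality of \<open>Z\<close> at \<open>b\<close> finishes.\<close>

lemma below_trans:
  assumes "x \<in> V" "y \<in> V" "below x y" "below y z"
  shows "below x z"
proof -
  obtain Z where Z: "separated Z" "H x \<subseteq> Z" "H y \<subseteq> Z" "critical_over Z (H x)"
    using assms(3) by (auto simp: below_def)
  obtain Z' where Z': "separated Z'" "H y \<subseteq> Z'" "H z \<subseteq> Z'" "critical_over Z' (H y)"
    using assms(4) by (auto simp: below_def)
  have Fx: "F (Z - H x)"
    by (intro separated_matchable separated_Diff separated_H Z assms)
  have FP: "F (Z' - Z)"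
    by (intro separated_matchable separated_Diff Z Z')
  have "critical_over (Z \<union> Z') (H x)"
    unfolding critical_over_def
  proof
    fix v assume v: "v \<in> Z \<union> Z' - H x"
    show "\<exists>w\<in>H x. F (insert w (Z \<union> Z' - H x - {v}))"
    proof (cases "v \<in> Z")
      case True
      then obtain w where w: "w \<in> H x" "F (insert w (Z - H x - {v}))"
        using critical_overD[OF Z(4) True] v by blast
      have "insert w (Z - H x - {v}) \<inter> (Z' - Z) = {}" using w Z by auto
      then have "F (insert w (Z - H x - {v}) \<union> (Z' - Z))" using w FP by (intro matchable_Un) auto
      moreover have "insert w (Z - H x - {v}) \<union> (Z' - Z) = insert w (Z \<union> Z' - H x - {v})"
        using Z True by blast
      ultimately show ?thesis using w by metis
    next
      case False
      then have "v \<in> Z' - H y" using v Z by auto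
      then obtain w2 where w2: "w2 \<in> H y" "F (insert w2 (Z' - H y - {v}))"
        using critical_overD[OF Z'(4), of v] by blast
      let ?P = "Z' - Z" and ?Q = "insert w2 (Z' - H y - {v})"
      have "v \<in> sym_diff ?P ?Q" using \<open>v \<in> Z' - H y\<close> False w2 by auto
      with FP w2(2) obtain b where b: "b \<in> sym_diff ?P ?Q" "b \<noteq> v" "F (sym_diff ?P {v, b})"
        by (rule matchable_exchange)
      \<comment> \<open>Outside \<open>Z\<close> the sets \<open>?P\<close> and \<open>?Q\<close>
        differ only in \<open>v\<close>, since \<open>H y \<subseteq> Z\<close>.\<close>
      have bZ: "b \<in> Z" using b(1,2) Z(3) w2(1) by auto
      have e: "sym_diff ?P {v, b} = insert b (?P - {v})"
        using bZ False \<open>v \<in> Z' - H y\<close> by blast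
      have Fb: "F (insert b (?P - {v}))" using b(3) by (simp only: e)
      show ?thesis
      proof (cases "b \<in> H x")
        case True
        have "insert b (?P - {v}) \<inter> (Z - H x) = {}" using True by blast
        then have "F (insert b (?P - {v}) \<union> (Z - H x))" using Fb Fx by (intro matchable_Un) auto
        moreover have "insert b (?P - {v}) \<union> (Z - H x) = insert b (Z \<union> Z' - H x - {v})"
          using Z(2) True False by blast
        ultimately show ?thesis using True by metis
      next
        case bH: False
        then obtain w where w: "w \<in> H x" "F (insert w (Z - H x - {b}))"
          using critical_overD[OF Z(4) bZ] by blast
        have "insert b (?P - {v}) \<inter> insert w (Z - H x - {b}) = {}" using w(1) Z(2) bH by blast
        then have "F (insert b (?P - {v}) \<union> insert w (Z - H x - {b}))"
          using Fb w by (intro matchable_Un) auto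
        moreover have "insert b (?P - {v}) \<union> insert w (Z - H x - {b})
            = insert w (Z \<union> Z' - H x - {v})"
          using Z(2) bH bZ False w(1) by blast
        ultimately show ?thesis using w by metis
      qed
    qed
  qed
  then show ?thesis
    using Z(2) Z'(3) separated_Un[OF Z(1) Z'(1)] unfolding below_def
    by (intro exI[of _ "Z \<union> Z'"]) auto
qed

section \<open>Perfect matchings of the whole graph as involutions\<close>

lemma mate_closed:
  assumes "\<And>a. a \<in> V \<Longrightarrow> m a \<in> V \<and> m a \<noteq> a \<and> m (m a) = a \<and> {a, m a} \<in> E"
    "T \<subseteq> V" "m ` T \<subseteq> T"
  shows "F T" "F (V - T)"
proof -
  show "F T"
    using assms finite_subset[OF assms(2) finite_V] by (intro matchable_if_mate[of T m]) blast+
  show "F (V - T)"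
  proof (rule matchable_if_mate[of _ m])
    fix a assume a: "a \<in> V - T"
    then have m: "m a \<in> V \<and> m a \<noteq> a \<and> m (m a) = a \<and> {a, m a} \<in> E" using assms(1) by blast
    then have "m a \<notin> T" using a assms(3) by (metis Diff_iff image_subset_iff)
    then show "m a \<in> V - T \<and> m a \<noteq> a \<and> m (m a) = a \<and> {a, m a} \<in> E" using m by blast
  qed (use finite_V in simp)
qed

lemma mate_allowed:
  assumes "\<And>a. a \<in> V \<Longrightarrow> m a \<in> V \<and> m a \<noteq> a \<and> m (m a) = a \<and> {a, m a} \<in> E" "a \<in> V"
  shows "{a, m a} \<in> allowed_edges"
proof -
  have "F (V - {a, m a})" by (rule mate_closed(2)[OF assms(1)]) (use assms in auto)
  then show ?thesis using assms by (simp add: allowed_edges_def)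
qed

lemma mate_V:
  obtains m where "\<And>a. a \<in> V \<Longrightarrow> m a \<in> V" "\<And>a. a \<in> V \<Longrightarrow> m (m a) = a"
    "\<And>a. a \<in> V \<Longrightarrow> {a, m a} \<in> allowed_edges"
    "\<And>T. T \<subseteq> V \<Longrightarrow> m ` T \<subseteq> T \<Longrightarrow> F T" "\<And>T. T \<subseteq> V \<Longrightarrow> m ` T \<subseteq> T \<Longrightarrow> F (V - T)"
proof -
  obtain m where "\<And>a. a \<in> V \<Longrightarrow> m a \<in> V" "\<And>a. a \<in> V \<Longrightarrow> m a \<noteq> a"
    "\<And>a. a \<in> V \<Longrightarrow> m (m a) = a" "\<And>a. a \<in> V \<Longrightarrow> {a, m a} \<in> E"
    using matchable_mate[OF matchable_V] by blast
  then have m: "\<And>a. a \<in> V \<Longrightarrow> m a \<in> V \<and> m a \<noteq> a \<and> m (m a) = a \<and> {a, m a} \<in> E" by blast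
  show ?thesis using that[of m] m mate_allowed[OF m] mate_closed[OF m] by blast
qed

lemma mate_V_extends:
  assumes "{x, y} \<in> allowed_edges"
  obtains m where "m x = y" "\<And>a. a \<in> V \<Longrightarrow> m (m a) = a"
    "\<And>a. a \<in> V \<Longrightarrow> {a, m a} \<in> allowed_edges"
    "\<And>T. T \<subseteq> V \<Longrightarrow> m ` T \<subseteq> T \<Longrightarrow> F (V - T)"
proof -
  have xy: "{x, y} \<in> E" "x \<in> V" "y \<in> V" "x \<noteq> y" using allowedD[OF assms] by auto
  obtain n where n: "\<And>a. a \<in> V - {x, y} \<Longrightarrow> n a \<in> V - {x, y}"
    "\<And>a. a \<in> V - {x, y} \<Longrightarrow> n a \<noteq> a"
    "\<And>a. a \<in> V - {x, y} \<Longrightarrow> n (n a) = a" "\<And>a. a \<in> V - {x, y} \<Longrightarrow> {a, n a} \<in> E"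
    using matchable_mate[of E "V - {x, y}"] assms unfolding allowed_edges_def by blast
  define m where "m = n(x := y, y := x)"
  have m: "m a \<in> V \<and> m a \<noteq> a \<and> m (m a) = a \<and> {a, m a} \<in> E" if "a \<in> V" for a
  proof (cases "a \<in> {x, y}")
    case True
    then show ?thesis using xy by (auto simp: m_def insert_commute)
  next
    case False
    then have a: "a \<in> V - {x, y}" using that by blast
    then have "n a \<in> V - {x, y}" by (rule n(1))
    then show ?thesis using False n(2-4)[OF a] by (simp add: m_def)
  qed
  show ?thesis
    using that[of m] m mate_allowed[OF m] mate_closed(2)[OF m] xy by (simp add: m_def)
qed

lemma mate_in_H: "{a, b} \<in> allowed_edges \<Longrightarrow> b \<in> H a"
  using H_step[OF H_self] .

text \<open>Moving the exposed vertex of \<open>H x\<close> across its mate turns the matching that witnesses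
  criticality into a near-perfect matching of \<open>G\<close> minus \<open>v\<close>.\<close>

lemma critical_over_R:
  assumes "x \<in> V" "separated Z" "H x \<subseteq> Z" "critical_over Z (H x)" "v \<in> Z - H x"
  obtains w where "w \<in> H x" "w \<in> R v"
proof -
  obtain m where m: "\<And>a. a \<in> V \<Longrightarrow> m a \<in> V" "\<And>a. a \<in> V \<Longrightarrow> m (m a) = a"
    "\<And>a. a \<in> V \<Longrightarrow> {a, m a} \<in> allowed_edges"
    "\<And>T. T \<subseteq> V \<Longrightarrow> m ` T \<subseteq> T \<Longrightarrow> F T"
    using mate_V by metis
  obtain w where w: "w \<in> H x" "F (insert w (Z - H x - {v}))"
    using critical_overD[OF assms(4), of v] assms(5) by blast
  have wV: "w \<in> V" using w H_subset_V[OF assms(1)] by auto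
  have mw: "m w \<in> H x" using mate_in_H[OF m(3)[OF wV]] H_eq[OF w(1)] by simp
  have ne: "m w \<noteq> w" using allowedD[OF m(3)[OF wV]] by auto
  have "F (H x - {w, m w})"
  proof (rule m(4))
    show "H x - {w, m w} \<subseteq> V" using H_subset_V[OF assms(1)] by blast
    show "m ` (H x - {w, m w}) \<subseteq> H x - {w, m w}"
    proof
      fix y assume "y \<in> m ` (H x - {w, m w})"
      then obtain a where a: "y = m a" "a \<in> H x" "a \<noteq> w" "a \<noteq> m w" by blast
      have aV: "a \<in> V" using a H_subset_V[OF assms(1)] by auto
      have "m a \<in> H x" using mate_in_H[OF m(3)[OF aV]] H_eq[OF a(2)] by simp
      moreover have "m a \<noteq> w" "m a \<noteq> m w" using a m(2)[OF aV] m(2)[OF wV] by metis+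
      ultimately show "y \<in> H x - {w, m w}" using a by simp
    qed
  qed
  moreover have "(H x - {w, m w}) \<inter> insert w (Z - H x - {v}) = {}" by blast
  ultimately have "F ((H x - {w, m w}) \<union> insert w (Z - H x - {v}))"
    using w(2) by (intro matchable_Un)
  moreover have "(H x - {w, m w}) \<union> insert w (Z - H x - {v}) = Z - {v, m w}"
    using w(1) mw ne assms(3,5) by blast
  ultimately have FZ: "F (Z - {v, m w})" by simp
  moreover have "F (V - Z)" by (intro separated_matchable separated_Diff separated_V assms)
  moreover have "(Z - {v, m w}) \<inter> (V - Z) = {}" by blast
  ultimately have "F ((Z - {v, m w}) \<union> (V - Z))" by (intro matchable_Un)
  moreover have "(Z - {v, m w}) \<union> (V - Z) = V - {v, m w}"
    using assms(2,3,5) mw by (auto simp: separated_def)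
  ultimately have "F (V - {v, m w})" by simp
  then have "m w \<in> R v" using assms(5) mw m(1)[OF wV] by (auto simp: in_R_iff)
  then show ?thesis using that mw by blast
qed

section \<open>Counting components against barrier vertices\<close>

lemma K_disjoint: "t \<in> K u k \<Longrightarrow> t \<in> K u k' \<Longrightarrow> K u k = K u k'"
  using component_eq[of t E "R u" k] component_eq[of t E "R u" k'] by simp

text \<open>Otherwise \<open>m\<close> would match a set of odd size within itself. The hypotheses
  concern \<open>m\<close> on this component only, so \<open>m\<close> may also come from a matching
  that leaves other vertices exposed.\<close>

lemma exit_of_K:
  assumes "u \<in> V" "k \<in> R u" "\<And>a. a \<in> K u k \<Longrightarrow> {a, m a} \<in> E"
    "\<And>a. a \<in> K u k \<Longrightarrow> m (m a) = a"
  obtains a where "a \<in> K u k" "m a \<in> X u"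
proof (rule ccontr)
  assume no: "\<not> thesis"
  have "F (K u k)"
  proof (rule matchable_if_mate[OF finite_K[OF assms(2)]])
    fix a assume a: "a \<in> K u k"
    then have "m a \<in> K u k" using K_step[OF a assms(2) assms(3)[OF a]] no that by blast
    then show "m a \<in> K u k \<and> m a \<noteq> a \<and> m (m a) = a \<and> {a, m a} \<in> E"
      using assms(3)[OF a] assms(4)[OF a] edgeD[of a "m a"] by metis
  qed
  then show False using odd_K[OF assms(1,2)] matchable_even by blast
qed

text \<open>Two mates in one component contradict \<open>two_exits\<close>. Together with
  \<open>mates_cover_K\<close> this gives the bijection between \<open>X u\<close> and the
  components of \<open>G[R u]\<close>.\<close>

lemma mates_distinct_K:
  assumes u: "u \<in> V" and z: "z \<in> X u" "z' \<in> X u" "z \<noteq> z'"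
    and m: "\<And>a. a \<in> V \<Longrightarrow> m (m a) = a"
    "\<And>a. a \<in> V \<Longrightarrow> {a, m a} \<in> allowed_edges"
    "\<And>T. T \<subseteq> V \<Longrightarrow> m ` T \<subseteq> T \<Longrightarrow> F (V - T)"
  shows "m z' \<notin> K u (m z)"
proof
  assume *: "m z' \<in> K u (m z)"
  have zV: "z \<in> V" "z' \<in> V" using z X_subset_V[OF u] by auto
  note al = m(2)[OF zV(1)] m(2)[OF zV(2)]
  have "F (V - {z, z', m z, m z'})"
    by (rule m(3)) (use zV m(1) allowedD[OF al(1)] allowedD[OF al(2)] in auto)
  moreover have "m z \<in> R u" using allowed_X[OF u z(1)] al by blast
  moreover have "m z \<noteq> m z'" using m(1)[OF zV(1)] m(1)[OF zV(2)] z(3) by metis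
  moreover have "m z \<in> R z" using allowedD[OF al(1)] by blast
  ultimately show False using two_exits[of u z z' "m z" "m z'"] u z * by blast
qed

lemma mates_cover_K:
  assumes u: "u \<in> V" "k \<in> R u"
    and m: "\<And>a. a \<in> V \<Longrightarrow> m (m a) = a"
    "\<And>a. a \<in> V \<Longrightarrow> {a, m a} \<in> allowed_edges"
  obtains x where "x \<in> X u" "m x \<in> K u k"
proof -
  have KV: "K u k \<subseteq> V" using K_subset[OF u(2)] R_subset_V by blast
  obtain a where a: "a \<in> K u k" "m a \<in> X u"
    using exit_of_K[OF u, of m] m KV allowedD by (metis subsetD)
  then have "m (m a) \<in> K u k" using m(1) KV by auto
  then show ?thesis using that[of "m a"] a by simp
qed

text \<open>If some \<open>z \<in> X x \<inter> Z\<close> lay outside \<open>H x\<close>, a perfect matching of \<open>G - z - w\<close> with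
  \<open>w \<in> H x\<close> would have to match \<open>X x \<inter> H x\<close> into the components of \<open>R x\<close> meeting \<open>H x\<close> (all edges
  from \<open>X x \<inter> H x\<close> to \<open>R x\<close> are allowed), avoiding the one that contains \<open>w\<close>: one too few.\<close>

lemma X_inter_subset_H:
  assumes "x \<in> V" "separated Z" "H x \<subseteq> Z" "critical_over Z (H x)"
  shows "X x \<inter> Z \<subseteq> H x"
proof (rule ccontr)
  assume "\<not> X x \<inter> Z \<subseteq> H x"
  then obtain z where z: "z \<in> X x" "z \<in> Z - H x" by auto
  obtain w where w: "w \<in> H x" "w \<in> R z" using critical_over_R[OF assms z(2)] by blast
  have wR: "w \<in> R x" using w R_subset_R[OF assms(1) z(1)] by blast
  obtain m where m: "\<And>a. a \<in> V \<Longrightarrow> m a \<in> V" "\<And>a. a \<in> V \<Longrightarrow> m (m a) = a"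
    "\<And>a. a \<in> V \<Longrightarrow> {a, m a} \<in> allowed_edges"
    "\<And>T. T \<subseteq> V \<Longrightarrow> m ` T \<subseteq> T \<Longrightarrow> F (V - T)"
    using mate_V by metis
  obtain n where n: "\<And>a. a \<in> V - {z, w} \<Longrightarrow> n a \<in> V - {z, w}"
    "\<And>a. a \<in> V - {z, w} \<Longrightarrow> n (n a) = a" "\<And>a. a \<in> V - {z, w} \<Longrightarrow> {a, n a} \<in> E"
    using matchable_mate[of E "V - {z, w}"] w(2) unfolding in_R_iff by metis
  note XV = X_subset_V[OF assms(1)]
  define S where "S = X x \<inter> H x"
  define \<K> where "\<K> = K x ` R x"
  define \<K>H where "\<K>H = {C \<in> \<K>. C \<inter> H x \<noteq> {}}"
  have fin: "finite (X x)" "finite \<K>" "finite S" "finite \<K>H"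
    using finite_subset[OF XV finite_V] finite_subset[OF R_subset_V finite_V, of x]
    by (auto simp: S_def \<K>_def \<K>H_def)
  have mR: "m a \<in> R x" if "a \<in> X x" for a
    using allowed_X[OF assms(1) that m(3)] that XV by blast
  have "inj_on (\<lambda>a. K x (m a)) (X x)"
  proof (rule inj_onI, rule ccontr)
    fix a b assume *: "a \<in> X x" "b \<in> X x" "K x (m a) = K x (m b)" "a \<noteq> b"
    have "m b \<notin> K x (m a)" using *(1,2,4) m(2,3,4) by (intro mates_distinct_K[OF assms(1)])
    then show False using *(3) by simp
  qed
  moreover have "(\<lambda>a. K x (m a)) ` X x \<subseteq> \<K>" using mR by (auto simp: \<K>_def)
  ultimately have XK: "card (X x) \<le> card \<K>" using card_inj_on_le fin by blast
  have Kw: "K x w \<in> \<K>H" using w(1) wR component_self[of w E "R x"] unfolding \<K>H_def \<K>_def by blast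
  \<comment> \<open>A component other than that of \<open>w\<close> is completely covered by
    \<open>n\<close>: it avoids \<open>w\<close>, and it avoids \<open>z\<close> because
    \<open>z \<notin> R x\<close>. Being odd, it is joined by \<open>n\<close> to the barrier, and
    not to the exposed vertex \<open>z\<close>.\<close>
  have "\<exists>s\<in>X x - {z}. n s \<in> C" if C: "C \<in> \<K> - {K x w}" for C
  proof -
    obtain k where k: "k \<in> R x" "C = K x k" using C by (auto simp: \<K>_def)
    have CV: "a \<in> V - {z, w}" if "a \<in> K x k" for a
    proof -
      have "K x a = C" using component_eq[OF that] k(2) by simp
      then have "a \<noteq> w" using C by blast
      moreover have "a \<in> R x" using K_subset[OF k(1)] that by blast
      ultimately show ?thesis using R_subset_V X_R_disjoint[OF z(1)] by blast
    qed
    obtain a where a: "a \<in> K x k" "n a \<in> X x"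
      using exit_of_K[OF assms(1) k(1), of n] n CV by metis
    have "n a \<noteq> z" using n(1)[OF CV[OF a(1)]] by blast
    moreover have "n (n a) \<in> C" using n(2)[OF CV[OF a(1)]] a k by simp
    ultimately show ?thesis using a by blast
  qed
  then obtain e where e: "\<And>C. C \<in> \<K> - {K x w} \<Longrightarrow> e C \<in> X x - {z} \<and> n (e C) \<in> C" by metis
  have inj_e: "inj_on e (\<K> - {K x w})"
  proof (rule inj_onI)
    fix C D assume *: "C \<in> \<K> - {K x w}" "D \<in> \<K> - {K x w}" "e C = e D"
    then have "n (e C) \<in> C" "n (e C) \<in> D" using e by metis+
    then show "C = D" using * K_disjoint unfolding \<K>_def by blast
  qed
  \<comment> \<open>The injection \<open>e\<close> maps into a set that is no larger than its
    domain, so it is onto: every barrier vertex except \<open>z\<close> is matched by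
    \<open>n\<close> into one of these components.\<close>
  have "card (X x - {z}) \<le> card (\<K> - {K x w})"
    using XK z(1) Kw fin by (auto simp: \<K>H_def card_Diff_singleton)
  then have "card (e ` (\<K> - {K x w})) \<ge> card (X x - {z})" using inj_e by (simp add: card_image)
  moreover have "e ` (\<K> - {K x w}) \<subseteq> X x - {z}" using e by blast
  ultimately have img: "e ` (\<K> - {K x w}) = X x - {z}" using fin by (intro card_seteq) auto
  have "S \<subseteq> e ` (\<K>H - {K x w})"
  proof
    fix s assume s: "s \<in> S"
    then have "s \<in> X x - {z}" using z(2) by (auto simp: S_def)
    then obtain C where C: "C \<in> \<K> - {K x w}" "s = e C" using img by blast
    have ns: "n s \<in> C" using e[OF C(1)] C by simp
    have nR: "n s \<in> R x" using ns C K_subset unfolding \<K>_def by blast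
    have "s \<noteq> w" using wR s X_R_disjoint by (auto simp: S_def)
    then have "s \<in> V - {z, w}" using s XV z(2) by (auto simp: S_def)
    then have "{s, n s} \<in> E" using n by blast
    \<comment> \<open>Although \<open>n\<close> leaves \<open>z\<close> and \<open>w\<close>
      exposed, its edge at \<open>s\<close> is allowed in \<open>G\<close>, because
      \<open>R s = R x\<close> for \<open>s \<in> S\<close>.\<close>
    moreover have "n s \<in> R s" using R_eq[OF assms(1), of s] s nR by (auto simp: S_def)
    ultimately have "n s \<in> H s" using allowedI mate_in_H by blast
    then have "n s \<in> H x" using H_eq[of s x] s by (auto simp: S_def)
    then have "C \<in> \<K>H - {K x w}" using C ns by (auto simp: \<K>H_def)
    then show "s \<in> e ` (\<K>H - {K x w})" using C by blast
  qed
  then have "card S \<le> card (\<K>H - {K x w})"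
    using fin by (meson card_image_le card_mono finite_Diff finite_imageI le_trans)
  also have "\<dots> < card \<K>H" using Kw fin by (intro psubset_card_mono) auto
  finally have less: "card S < card \<K>H" .
  \<comment> \<open>The opposite inequality comes from the perfect matching \<open>m\<close>: the
    allowed exits of a component that meets \<open>H x\<close> all belong to \<open>H x\<close>, so
    its barrier partner lies in \<open>S\<close>.\<close>
  have "\<exists>s\<in>S. m s \<in> C" if C: "C \<in> \<K>H" for C
  proof -
    obtain k where k: "k \<in> R x" "C = K x k" "k \<in> H x"
    proof -
      obtain k0 t where t: "k0 \<in> R x" "C = K x k0" "t \<in> C" "t \<in> H x"
        using C by (auto simp: \<K>H_def \<K>_def)
      then show ?thesis using that[of t] component_eq[of t E "R x" k0] K_subset by blast
    qed
    obtain s where s: "s \<in> X x" "m s \<in> K x k"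
      using mates_cover_K[OF assms(1) k(1) m(2,3)] by blast
    obtain y l where yl: "y \<in> X x" "y \<in> H x" "l \<in> K x k" "l \<in> H x" "{y, l} \<in> allowed_edges"
      using exit_exists[OF assms(1) k(1,3)] by auto
    have al: "{s, m s} \<in> allowed_edges" using m(3) s(1) XV by blast
    have "m s \<in> K x l" using component_eq[OF yl(3)] s(2) by simp
    then have "H (m s) = H l" using exits_same_H[OF assms(1) yl(1,5) s(1) al] by simp
    then have "H s = H x" using H_eq[OF mate_in_H[OF al]] H_eq[OF yl(4)] by simp
    then have "s \<in> S" using s(1) H_self[of s] by (simp add: S_def)
    then show ?thesis using s k by blast
  qed
  then obtain g where g: "\<And>C. C \<in> \<K>H \<Longrightarrow> g C \<in> S \<and> m (g C) \<in> C" by metis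
  have "inj_on g \<K>H"
  proof (rule inj_onI)
    fix C D assume *: "C \<in> \<K>H" "D \<in> \<K>H" "g C = g D"
    then have "m (g C) \<in> C" "m (g C) \<in> D" using g by metis+
    then show "C = D" using * K_disjoint unfolding \<K>H_def \<K>_def by blast
  qed
  moreover have "g ` \<K>H \<subseteq> S" using g by blast
  ultimately have "card \<K>H \<le> card S" using card_inj_on_le fin by blast
  then show False using less by simp
qed

text \<open>If the component of \<open>y\<close> in \<open>G[Z - H x]\<close> had no edge to
  \<open>H x\<close>, it would be matchable both with and without \<open>y\<close>, against
  parity.\<close>

lemma critical_over_attached:
  assumes "x \<in> V" "separated Z" "H x \<subseteq> Z" "critical_over Z (H x)" "y \<in> Z - H x"
  obtains w a where "w \<in> H x" "a \<in> component E (Z - H x) y" "{a, w} \<in> E"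
proof (rule ccontr)
  assume no: "\<not> thesis"
  let ?Y = "component E (Z - H x) y"
  have Ysub: "?Y \<subseteq> Z - H x" using component_subset[OF assms(5)] .
  obtain w where w: "w \<in> H x" "F (insert w (Z - H x - {y}))"
    using critical_overD[OF assms(4), of y] assms(5) by blast
  have "F (Z - H x)" by (intro separated_matchable separated_Diff separated_H assms)
  then have "F ?Y"
    using Ysub component_step[of _ E "Z - H x" y] by (intro matchable_closed[of E "Z - H x" ?Y]) blast+
  moreover have "F (?Y - {y})"
  proof (rule matchable_closed[OF w(2)])
    show "?Y - {y} \<subseteq> insert w (Z - H x - {y})" using Ysub by blast
    fix a b assume *: "a \<in> ?Y - {y}" "b \<in> insert w (Z - H x - {y}) - (?Y - {y})" "{a, b} \<in> E"
    then have "b \<noteq> w" using no that w by blast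
    then have "b \<in> ?Y" using component_step[of a E "Z - H x" y b] * Ysub by blast
    then show "\<not> F (insert w (Z - H x - {y}) - {a, b})" using * \<open>b \<noteq> w\<close> by blast
  qed
  moreover have "card ?Y = Suc (card (?Y - {y}))"
    using matchable_finite[OF \<open>F ?Y\<close>] by (subst card_Suc_Diff1) auto
  ultimately show False using matchable_even by (metis even_Suc)
qed

text \<open>Every neighbour of \<open>R u\<close> outside \<open>R u\<close> lies in
  \<open>X u\<close>, so a walk that avoids \<open>X u\<close> cannot leave
  \<open>R u\<close>.\<close>

lemma connected_in_K:
  assumes "y \<in> component E W a" "W \<inter> X u = {}" "a \<in> R u"
  shows "y \<in> K u a"
proof -
  have "y \<in> R u \<and> y \<in> K u a"
    using assms(1)
  proof (induction rule: component_induct)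
    case (step c d)
    then have "d \<in> R u" using R_neighbour[of c u d] assms(2) by blast
    then show ?case using component_step[of c E "R u" a d] step by blast
  qed (use assms in auto)
  then show ?thesis by blast
qed

text \<open>Choosing the mate of \<open>w\<close> as \<open>x'\<close>, and not \<open>w\<close>
  itself, puts \<open>w\<close> into \<open>R x'\<close>. The connected set attached to
  \<open>w\<close> avoids \<open>X x'\<close> and is therefore absorbed by
  \<open>K x' w\<close>.\<close>

lemma below_arc:
  assumes "x \<in> V" "below x y" "y \<notin> H x"
  obtains x' k where "x' \<in> H x" "k \<in> R x'" "k \<in> H x'" "y \<in> K x' k"
proof -
  obtain Z where Z: "separated Z" "H x \<subseteq> Z" "H y \<subseteq> Z" "critical_over Z (H x)"
    using assms(2) by (auto simp: below_def)
  have yZ: "y \<in> Z - H x" using Z(3) assms(3) H_self by blast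
  obtain w a where w: "w \<in> H x" "a \<in> component E (Z - H x) y" "{a, w} \<in> E"
    using critical_over_attached[OF assms(1) Z(1,2,4) yZ] by blast
  obtain m where m: "\<And>a. a \<in> V \<Longrightarrow> {a, m a} \<in> allowed_edges" using mate_V by metis
  define x' where "x' = m w"
  have al: "{w, x'} \<in> allowed_edges" using m w(1) H_subset_V[OF assms(1)] by (auto simp: x'_def)
  have H: "x' \<in> H x" "H x' = H x" using mate_in_H[OF al] H_eq[OF w(1)] H_eq by auto
  have x'V: "x' \<in> V" using allowedD[OF al] by blast
  have disj: "(Z - H x) \<inter> X x' = {}"
    using X_inter_subset_H[OF x'V Z(1)] Z(2,4) H by auto
  have wR: "w \<in> R x'" using allowedD[OF al] by blast
  have aW: "a \<in> Z - H x" using component_subset[OF yZ] w(2) by blast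
  have aK: "a \<in> K x' w" using K_step[OF component_self wR, of a] w(3) aW disj edge_sym by blast
  then have "a \<in> R x'" using K_subset[OF wR] by blast
  then have "y \<in> K x' a" using connected_in_K[OF component_sym[OF w(2)] disj] by blast
  then have "y \<in> K x' w" using component_eq[OF aK] by blast
  then show ?thesis using that[of x' w] H w(1) wR by blast
qed

text \<open>Let \<open>w \<in> H x\<close> be adjacent to \<open>a\<close> in the component of
  \<open>y\<close> in \<open>G[Z - H x]\<close>. The edge leaves \<open>H x\<close>, so it is not
  allowed and \<open>a \<notin> R w\<close>. Criticality over \<open>H y\<close> gives some
  \<open>t \<in> H y \<inter> R w\<close>; since \<open>t\<close> and \<open>a\<close> are connected
  without meeting \<open>X w\<close>, also \<open>a \<in> R w\<close>.\<close>

lemma below_antisym: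
  assumes "x \<in> V" "y \<in> V" "below x y" "below y x"
  shows "H x = H y"
proof (rule ccontr)
  assume ne: "H x \<noteq> H y"
  obtain Z where Z: "separated Z" "H x \<subseteq> Z" "H y \<subseteq> Z" "critical_over Z (H x)"
    using assms(3) by (auto simp: below_def)
  obtain Z' where Z': "separated Z'" "H y \<subseteq> Z'" "H x \<subseteq> Z'" "critical_over Z' (H y)"
    using assms(4) by (auto simp: below_def)
  have disj: "H x \<inter> H y = {}" using ne H_eq by blast
  have yZ: "y \<in> Z - H x" using Z(3) disj H_self by blast
  obtain w a where w: "w \<in> H x" "a \<in> component E (Z - H x) y" "{a, w} \<in> E"
    using critical_over_attached[OF assms(1) Z(1,2,4) yZ] by blast
  have wV: "w \<in> V" using w H_subset_V[OF assms(1)] by blast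
  have Hw: "H w = H x" using H_eq[OF w(1)] .
  have X: "(Z - H x) \<inter> X w = {}" using X_inter_subset_H[OF wV Z(1)] Z(2,4) Hw by auto
  have aW: "a \<in> Z - H x" using component_subset[OF yZ] w(2) by blast
  have aR: "a \<notin> R w"
  proof
    assume "a \<in> R w"
    then have "a \<in> H w" using allowedI[of w a] w(3) mate_in_H edge_sym by blast
    then show False using Hw aW by blast
  qed
  have "w \<in> Z' - H y" using w(1) Z'(3) disj by blast
  then obtain t where t: "t \<in> H y" "t \<in> R w" using critical_over_R[OF assms(2) Z'(1,2,4)] by blast
  have "t \<in> component E (Z - H x) y"
    using t(1)[unfolded H_def]
  proof (induction rule: component_induct)
    case (step c d)
    have "c \<in> H y" using step by (simp add: H_def)
    then have "c \<in> Z - H x" "d \<in> Z - H x" using H_step[of c y d] step(4) Z(3) disj by blast+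
    then show ?case using component_step[OF step(5)] step(4) allowedD by blast
  qed simp
  then have "component E (Z - H x) t = component E (Z - H x) a" using component_eq w(2) by metis
  then have "a \<in> component E (Z - H x) t" by simp
  then have "a \<in> K w t" using connected_in_K X t(2) by blast
  then show False using K_subset[OF t(2)] aR by blast
qed

section \<open>Reachability along the arcs of the algorithm\<close>

definition arcs_from :: "'a \<Rightarrow> 'a \<Rightarrow> 'a set" where
  "arcs_from u x = (\<Union>k\<in>R u \<inter> H x. K u k)"

lemma arcs_fromI: "k \<in> R u \<Longrightarrow> k \<in> H x \<Longrightarrow> k \<in> arcs_from u x"
  unfolding arcs_from_def using component_self by (intro UN_I[of k]) auto

text \<open>\<open>arcs_from u x\<close> will turn out to be the set of heads drawn from
  \<open>x\<close> in the round of \<open>u\<close>. A vertex may be registered in the round of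
  another vertex; that round draws at least the arcs which its own round would draw.\<close>

lemma arcs_from_mono:
  assumes "u \<in> V" "x \<in> X u"
  shows "arcs_from x x \<subseteq> arcs_from u x"
proof
  fix y assume "y \<in> arcs_from x x"
  then obtain k where k: "k \<in> R x" "k \<in> H x" "y \<in> K x k" by (auto simp: arcs_from_def)
  have R: "R x \<subseteq> R u" using R_subset_R[OF assms] .
  have "y \<in> K u k" using component_mono[OF R] k(3) by (rule subsetD)
  then show "y \<in> arcs_from u x" using k R by (auto simp: arcs_from_def)
qed

lemma below_if_same_H: "x \<in> V \<Longrightarrow> H x = H y \<Longrightarrow> below x y"
  using separated_H[of x] unfolding below_def critical_over_def by (metis Diff_iff subset_refl)

text \<open>The two assumptions on \<open>A\<close> hold for every run, whatever choices are made.
  An arc goes upwards by \<open>arc_below\<close>; conversely each factor-component is strongly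
  connected, and \<open>below_arc\<close> supplies one further arc.\<close>

lemma reach_iff_below:
  assumes sound: "\<And>x y. (x, y) \<in> A \<Longrightarrow> \<exists>u\<in>V. x \<in> X u \<and> y \<in> arcs_from u x"
    and complete: "\<And>x. x \<in> V \<Longrightarrow> \<exists>u\<in>V. x \<in> X u \<and> {x} \<times> arcs_from u x \<subseteq> A"
    and xy: "x \<in> V" "y \<in> V"
  shows "(x, y) \<in> A\<^sup>* \<longleftrightarrow> below x y"
proof
  assume "(x, y) \<in> A\<^sup>*"
  then have "y \<in> V \<and> below x y"
  proof (induction rule: rtrancl_induct)
    case (step a b)
    obtain u where "u \<in> V" "a \<in> X u" "b \<in> arcs_from u a" using sound[OF step.hyps(2)] by blast
    then obtain k where u: "u \<in> V" "a \<in> X u" "k \<in> R u" "k \<in> H a" "b \<in> K u k"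
      by (auto simp: arcs_from_def)
    then have "below a b" using arc_below by blast
    moreover have "b \<in> V" using K_subset[OF u(3)] u(5) R_subset_V by blast
    ultimately show ?case using below_trans[OF xy(1), of a b] step.IH by blast
  qed (use xy below_if_same_H[of x x] in simp)
  then show "below x y" by blast
next
  have arc: "(a, b) \<in> A" if "a \<in> V" "b \<in> arcs_from a a" for a b
    using complete[OF that(1)] arcs_from_mono that by blast
  obtain m where m: "\<And>a. a \<in> V \<Longrightarrow> {a, m a} \<in> allowed_edges" using mate_V by metis
  have same: "(a, b) \<in> A\<^sup>*" if ab: "a \<in> V" "b \<in> H a" for a b
  proof -
    have bV: "b \<in> V" using ab H_subset_V by blast
    obtain u where u: "u \<in> V" "a \<in> X u" "{a} \<times> arcs_from u a \<subseteq> A" using complete[OF ab(1)] by blast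
    show ?thesis
    proof (cases "b \<in> R u")
      case True
      then have "b \<in> arcs_from u a" using ab arcs_fromI by blast
      then show ?thesis using u by blast
    next
      \<comment> \<open>The round of \<open>u\<close> draws no arc into \<open>X u\<close>. The
        detour passes through the mate of \<open>b\<close>, which lies in \<open>R u\<close> and has
        an arc to \<open>b\<close>.\<close>
      case False
      then have "b \<in> X u" using H_subset_X_R[OF u(1,2)] ab by blast
      note mb = m[OF bV]
      have mR: "m b \<in> R u" using allowed_X[OF u(1) \<open>b \<in> X u\<close> mb] .
      have "m b \<in> H a" using H_step[OF ab(2) mb] .
      then have "m b \<in> arcs_from u a" using mR arcs_fromI by blast
      then have 1: "(a, m b) \<in> A" using u by blast
      have "b \<in> H (m b)" "b \<in> R (m b)" using mate_in_H mb allowed_sym allowedD by blast+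
      then have "b \<in> arcs_from (m b) (m b)" by (intro arcs_fromI)
      then have "(m b, b) \<in> A" using arc allowedD[OF mb] by blast
      then show ?thesis using 1 by auto
    qed
  qed
  assume b: "below x y"
  show "(x, y) \<in> A\<^sup>*"
  proof (cases "y \<in> H x")
    case False
    then obtain x' k where x': "x' \<in> H x" "k \<in> R x'" "k \<in> H x'" "y \<in> K x' k"
      using below_arc[OF xy(1) b] by blast
    have "y \<in> arcs_from x' x'" using x'(2-4) by (auto simp: arcs_from_def)
    then have "(x', y) \<in> A" using arc[of x' y] H_subset_V[OF xy(1)] x'(1) by blast
    then show ?thesis using same[OF xy(1) x'(1)] by (rule rtrancl_into_rtrancl[rotated])
  qed (use same xy in blast)
qed

end

section \<open>Matchings, contractions and factor-critical graphs\<close>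

lemma matchable_matching:
  assumes "matchable E A"
  obtains M where "M \<subseteq> E" "\<And>e f. e \<in> M \<Longrightarrow> f \<in> M \<Longrightarrow> e \<noteq> f \<Longrightarrow> e \<inter> f = {}" "\<Union>M = A"
proof -
  have "\<exists>M\<subseteq>E. (\<forall>e\<in>M. \<forall>f\<in>M. e \<noteq> f \<longrightarrow> e \<inter> f = {}) \<and> \<Union>M = A"
    using assms
  proof (induction rule: matchable.induct)
    case (insert A a b)
    then obtain M where M: "M \<subseteq> E" "\<forall>e\<in>M. \<forall>f\<in>M. e \<noteq> f \<longrightarrow> e \<inter> f = {}" "\<Union>M = A" by auto
    have "\<forall>e\<in>M. e \<inter> {a, b} = {}" using M(3) insert.hyps by blast
    then show ?case using M insert.hyps by (intro exI[of _ "insert {a, b} M"]) auto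
  qed auto
  then show ?thesis using that by blast
qed

lemma matching_matchable:
  assumes "finite M" "M \<subseteq> E" "\<And>e. e \<in> M \<Longrightarrow> card e = 2"
    "\<And>e f. e \<in> M \<Longrightarrow> f \<in> M \<Longrightarrow> e \<noteq> f \<Longrightarrow> e \<inter> f = {}"
  shows "matchable E (\<Union>M)"
  using assms
proof (induction M rule: finite_induct)
  case (insert e M)
  obtain a b where e: "e = {a, b}" "a \<noteq> b" using insert.prems(2)[of e] by (auto simp: card_2_iff)
  have "e \<inter> f = {}" if "f \<in> M" for f using insert.prems(3)[of e f] insert.hyps that by auto
  then have "a \<notin> \<Union>M" "b \<notin> \<Union>M" using e by auto
  moreover have "matchable E (\<Union>M)" using insert by auto
  ultimately have "matchable E (insert a (insert b (\<Union>M)))"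
    using insert.prems(1) e by (intro matchable.insert) auto
  then show ?case using e by simp
qed (auto intro: matchable.empty)

lemma simple_graph_edge: "simple_graph G \<Longrightarrow> e \<in> edges G \<Longrightarrow> e \<subseteq> nodes G \<and> card e = 2"
  by (auto simp: simple_graph_def)

lemma matching_finite:
  assumes "simple_graph G" "finite (nodes G)" "matching G M"
  shows "finite M"
proof -
  have "M \<subseteq> Pow (nodes G)" using assms by (auto simp: matching_def simple_graph_def)
  then show ?thesis using assms(2) by (meson finite_Pow_iff finite_subset)
qed

lemma matching_matchable_graph:
  assumes "simple_graph G" "finite (nodes G)" "matching G M"
  shows "matchable (edges G) (\<Union>M)"
  using assms(3) simple_graph_edge[OF assms(1)] unfolding matching_def
  by (intro matching_matchable matching_finite[OF assms]) blast+

lemma matching_card_Union: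
  assumes "simple_graph G" "finite (nodes G)" "matching G M"
  shows "card (\<Union>M) = 2 * card M"
proof -
  have c: "card e = 2" if "e \<in> M" for e
    using that assms(3) simple_graph_edge[OF assms(1), of e] by (auto simp: matching_def)
  then have f: "finite e" if "e \<in> M" for e using that by (metis card.infinite zero_neq_numeral)
  have "pairwise disjnt M" using assms(3) by (auto simp: matching_def pairwise_def disjnt_def)
  then have "card (\<Union>M) = sum card M" using f by (intro card_Union_disjoint) auto
  also have "\<dots> = 2 * card M" using c by simp
  finally show ?thesis .
qed

lemma perfect_matching_iff:
  "simple_graph G \<Longrightarrow> perfect_matching G M \<longleftrightarrow> matching G M \<and> \<Union>M = nodes G"
  by (auto simp: perfect_matching_def matching_def exposed_def simple_graph_def)

lemma factorizable_iff:
  assumes "simple_graph G" "finite (nodes G)"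
  shows "factorizable G \<longleftrightarrow> matchable (edges G) (nodes G)"
proof
  assume "factorizable G"
  then obtain M where "matching G M" "\<Union>M = nodes G"
    by (auto simp: factorizable_def perfect_matching_iff[OF assms(1)])
  then show "matchable (edges G) (nodes G)" using matching_matchable_graph[OF assms] by metis
next
  assume "matchable (edges G) (nodes G)"
  then obtain M where "M \<subseteq> edges G" "\<And>e f. e \<in> M \<Longrightarrow> f \<in> M \<Longrightarrow> e \<noteq> f \<Longrightarrow> e \<inter> f = {}"
    "\<Union>M = nodes G"
    by (rule matchable_matching) blast
  then have "matching G M" "\<Union>M = nodes G" by (auto simp: matching_def)
  then show "factorizable G"
    by (auto simp: factorizable_def perfect_matching_iff[OF assms(1)])
qed

lemma allowed_iff:
  assumes "simple_graph G" "finite (nodes G)"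
  shows "allowed G e \<longleftrightarrow> e \<in> edges G \<and> matchable (edges G) (nodes G - e)"
proof
  assume "allowed G e"
  then obtain M where M: "e \<in> edges G" "e \<in> M" "matching G M" "\<Union>M = nodes G"
    by (auto simp: allowed_def perfect_matching_iff[OF assms(1)])
  have "matching G (M - {e})" using M by (auto simp: matching_def)
  then have "matchable (edges G) (\<Union>(M - {e}))" by (rule matching_matchable_graph[OF assms])
  moreover have "f \<inter> e = {}" if "f \<in> M - {e}" for f
    using M(2,3) that by (auto simp: matching_def)
  then have "\<Union>(M - {e}) = nodes G - e" unfolding M(4)[symmetric] using M(2) by blast
  ultimately show "e \<in> edges G \<and> matchable (edges G) (nodes G - e)" using M(1) by simp
next
  assume e: "e \<in> edges G \<and> matchable (edges G) (nodes G - e)"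
  then obtain M where M: "M \<subseteq> edges G" "\<And>e f. e \<in> M \<Longrightarrow> f \<in> M \<Longrightarrow> e \<noteq> f \<Longrightarrow> e \<inter> f = {}"
    "\<Union>M = nodes G - e"
    by (meson matchable_matching)
  have "f \<inter> e = {}" if "f \<in> M" for f
  proof -
    have "f \<subseteq> nodes G - e" unfolding M(3)[symmetric] using that by blast
    then show ?thesis by blast
  qed
  then have "matching G (insert e M)"
    using M(1,2) e by (auto simp: matching_def Int_commute)
  moreover have "\<Union>(insert e M) = nodes G"
    using M(3) simple_graph_edge[OF assms(1), of e] e by auto
  ultimately show "allowed G e"
    unfolding allowed_def perfect_matching_iff[OF assms(1)] using e
    by (intro conjI exI[of _ "insert e M"]) auto
qed

section \<open>Components, vertex deletion and contraction\<close>

lemma component_sets_eq: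
  assumes "\<And>e. e \<in> edges G \<Longrightarrow> e \<subseteq> nodes G"
  shows "component_sets G = component (edges G) (nodes G) ` nodes G"
proof -
  have adj: "{(x, y). {x, y} \<in> edges G} = adjacency (edges G) (nodes G)"
    using assms by (auto simp: adjacency_def)
  have "{(u, v). u \<in> nodes G \<and> v \<in> nodes G \<and> (u, v) \<in> (adjacency (edges G) (nodes G))\<^sup>*} `` {x}
      = component (edges G) (nodes G) x" if "x \<in> nodes G" for x
    using component_subset[OF that, of "edges G"] that by (auto simp: component_def)
  then show ?thesis unfolding component_sets_def adj quotient_def by auto
qed

lemma delete_nodes_simps [simp]:
  "nodes (delete_nodes G W) = nodes G - W"
  "edges (delete_nodes G W) = {e \<in> edges G. e \<subseteq> nodes G - W}"
  by (auto simp: delete_nodes_def induce_def)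

lemma simple_delete_nodes: "simple_graph G \<Longrightarrow> simple_graph (delete_nodes G W)"
  by (auto simp: simple_graph_def)

lemma matchable_inside: "matchable {e \<in> E. e \<subseteq> A} A \<longleftrightarrow> matchable E A"
proof
  assume "matchable E A"
  then show "matchable {e \<in> E. e \<subseteq> A} A"
    by (rule matchable_mono[OF matchable_allowed]) blast
next
  assume "matchable {e \<in> E. e \<subseteq> A} A"
  then show "matchable E A" by (rule matchable_mono) blast
qed

lemma factorizable_delete_nodes:
  assumes "simple_graph G" "finite (nodes G)"
  shows "factorizable (delete_nodes G W) \<longleftrightarrow> matchable (edges G) (nodes G - W)"
  using factorizable_iff[OF simple_delete_nodes[OF assms(1)], of W] assms(2)
  by (simp add: matchable_inside)

lemma contract_simps:
  "nodes (contract G P) = contract_nodes G P"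
  "{B, C} \<in> edges (contract G P) \<longleftrightarrow> B \<in> contract_nodes G P \<and> C \<in> contract_nodes G P \<and> B \<noteq> C \<and>
    (\<exists>b\<in>B. \<exists>c\<in>C. {b, c} \<in> edges G)"
proof -
  have "{b, c} \<in> edges G \<longleftrightarrow> {c, b} \<in> edges G" for b c by (simp add: insert_commute)
  then show "{B, C} \<in> edges (contract G P) \<longleftrightarrow> B \<in> contract_nodes G P \<and> C \<in> contract_nodes G P \<and>
    B \<noteq> C \<and> (\<exists>b\<in>B. \<exists>c\<in>C. {b, c} \<in> edges G)"
    unfolding contract_def by (simp add: doubleton_eq_iff) blast
qed (simp add: contract_def)

lemma simple_contract: "simple_graph (contract G P)"
  unfolding simple_graph_def contract_def by (auto simp: card_2_iff)

section \<open>Factor-components and their order for the given graph\<close>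

locale factorizable_graph =
  fixes G :: "'a ugraph"
  assumes fin: "finite_graph G" and fact: "factorizable G"
begin

abbreviation V :: "'a set" where "V \<equiv> nodes G"
abbreviation E :: "'a set set" where "E \<equiv> edges G"

lemma simple: "simple_graph G"
  using fin by (simp add: finite_graph_def)

lemma finite_nodes: "finite V"
  using fin by (simp add: finite_graph_def)

sublocale matchable_graph E V
  using simple_graph_edge[OF simple] factorizable_iff[OF simple finite_nodes] fact
  by unfold_locales auto

lemma allowed_subgraph_eq: "edges (allowed_subgraph G) = allowed_edges"
  by (auto simp: allowed_subgraph_def allowed_iff[OF simple finite_nodes] allowed_edges_def)

lemma factor_components_eq: "factor_components G = (\<lambda>x. induce G (H x)) ` V"
proof -
  have "nodes (allowed_subgraph G) = V" by (simp add: allowed_subgraph_def)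
  moreover have "e \<subseteq> V" if "e \<in> allowed_edges" for e
    using that edge_card by (auto simp: allowed_edges_def)
  ultimately have "component_sets (allowed_subgraph G) = H ` V"
    using component_sets_eq[of "allowed_subgraph G"] unfolding allowed_subgraph_eq H_def by simp
  then show ?thesis by (simp add: factor_components_def image_image)
qed

lemma nodes_induce_H: "x \<in> V \<Longrightarrow> nodes (induce G (H x)) = H x"
  using H_subset_V by (auto simp: induce_def)

lemma separating_iff: "separating G Z \<longleftrightarrow> separated Z"
proof
  assume Z: "separating G Z"
  show "separated Z" unfolding separated_def
  proof (intro conjI ballI)
    show ZV: "Z \<subseteq> V" using Z by (simp add: separating_def)
    fix x assume x: "x \<in> Z"
    then have "nodes (induce G (H x)) \<subseteq> Z \<or> nodes (induce G (H x)) \<inter> Z = {}"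
      using Z ZV unfolding separating_def factor_components_eq by blast
    then show "H x \<subseteq> Z" using nodes_induce_H[of x] x ZV H_self[of x] by blast
  qed
next
  assume Z: "separated Z"
  have "H x \<subseteq> Z \<or> H x \<inter> Z = {}" for x
  proof (cases "H x \<inter> Z = {}")
    case False
    then obtain t where "t \<in> H x" "t \<in> Z" by blast
    then show ?thesis using Z H_eq[of t x] by (auto simp: separated_def)
  qed simp
  then show "separating G Z"
    using Z nodes_induce_H by (auto simp: separating_def separated_def factor_components_eq)
qed

text \<open>Matchings of the contraction that avoid \<open>B\<close> are matchings of
  \<open>G[Z - B]\<close>; in the others the edge at \<open>B\<close> lifts to an edge at some
  \<open>w \<in> B\<close>. Deleting \<open>B\<close> leaves the separated set \<open>Z - B\<close>,
  so the condition comes from the other vertices.\<close>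

lemma factor_critical_contract_iff:
  assumes Z: "separated Z" "H x \<subseteq> Z" "x \<in> V"
  shows "factor_critical (contract (induce G Z) {H x}) \<longleftrightarrow> critical_over Z (H x)"
proof -
  define B where "B = H x"
  define C where "C = contract (induce G Z) {B}"
  have ZV: "Z \<subseteq> V" using Z by (simp add: separated_def)
  have BZ: "B \<subseteq> Z" using Z by (simp add: B_def)
  let ?s = "\<lambda>v. {v}"
  have cn: "contract_nodes (induce G Z) {B} = insert B (?s ` (Z - B))"
    using ZV by (auto simp: contract_nodes_def induce_def)
  then have nC: "nodes C = insert B (?s ` (Z - B))" by (simp add: C_def contract_simps)
  have finC: "finite (nodes C)" using finite_subset[OF ZV finite_nodes] by (simp add: nC)
  have sC: "simple_graph C" by (simp add: C_def simple_contract)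
  have Bs: "B \<notin> ?s ` (Z - B)" by auto
  have edge: "{b, c} \<in> edges (induce G Z) \<longleftrightarrow> {b, c} \<in> E" if "b \<in> Z" "c \<in> Z" for b c
    using that by (simp add: induce_def)
  have ss: "{{a}, {b}} \<in> edges C \<longleftrightarrow> {a, b} \<in> E" if "a \<in> Z - B" "b \<in> Z - B" for a b
    using that edge[of a b] edgeD[of a b] unfolding C_def contract_simps cn by auto
  have Bb: "{B, {b}} \<in> edges C \<longleftrightarrow> (\<exists>w\<in>B. {w, b} \<in> E)" if "b \<in> Z - B" for b
    using that edge[of _ b] BZ unfolding C_def contract_simps cn by blast
  have down: "F (\<Union>\<A>)" if "matchable (edges C) \<A>" "\<A> \<subseteq> ?s ` (Z - B)" for \<A>
    using that
  proof (induction rule: matchable.induct)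
    case (insert \<A> a b)
    then obtain a' b' where ab: "a = {a'}" "b = {b'}" "a' \<in> Z - B" "b' \<in> Z - B" by auto
    have "a' \<notin> \<Union>\<A>" "b' \<notin> \<Union>\<A>" using insert.prems insert.hyps ab by auto
    moreover have "{a', b'} \<in> E" using ss[of a' b'] insert.hyps ab by simp
    moreover have "a' \<noteq> b'" "F (\<Union>\<A>)" using insert ab by auto
    ultimately have "F (insert a' (insert b' (\<Union>\<A>)))" by (intro matchable.insert)
    then show ?case using ab by (simp add: insert_commute)
  qed (auto intro: matchable.empty)
  have up: "matchable (edges C) (?s ` A)" if "F A" "A \<subseteq> Z - B" for A
    using that
  proof (induction rule: matchable.induct)
    case (insert A a b)
    then have "{{a}, {b}} \<in> edges C" using ss by blast
    then have "matchable (edges C) (insert {a} (insert {b} (?s ` A)))"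
      using insert by (intro matchable.insert) auto
    then show ?case by simp
  qed (auto intro: matchable.empty)
  have single: "matchable (edges C) (?s ` A) \<longleftrightarrow> F A" if "A \<subseteq> Z - B" for A
  proof
    assume "matchable (edges C) (?s ` A)"
    then have "F (\<Union>(?s ` A))" using down that by blast
    then show "F A" by simp
  qed (use up that in blast)
  have withB: "matchable (edges C) (insert B (?s ` A)) \<longleftrightarrow> (\<exists>w\<in>B. F (insert w A))"
    if A: "A \<subseteq> Z - B" for A
  proof
    assume "matchable (edges C) (insert B (?s ` A))"
    then obtain N where N: "N \<in> insert B (?s ` A)" "N \<noteq> B" "{B, N} \<in> edges C"
      "matchable (edges C) (insert B (?s ` A) - {B, N})"
      using matchable_remove[of "edges C" "insert B (?s ` A)" B] by blast
    then obtain b where b: "N = {b}" "b \<in> A" by blast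
    have bZ: "b \<in> Z - B" using b A by blast
    obtain w where w: "w \<in> B" "{w, b} \<in> E" using N(3) Bb[OF bZ] b by blast
    have "insert B (?s ` A) - {B, N} = ?s ` (A - {b})" using b A Bs by auto
    then have FA: "F (A - {b})" using N(4) single[of "A - {b}"] A by auto
    have "insert w A - {w, b} = A - {b}" using w A by auto
    then have "F (insert w A)" using FA w b bZ by (intro matchable_addI[of E "insert w A" w b]) auto
    then show "\<exists>w\<in>B. F (insert w A)" using w by blast
  next
    assume "\<exists>w\<in>B. F (insert w A)"
    then obtain w where w: "w \<in> B" "F (insert w A)" by blast
    then obtain b where b: "b \<in> insert w A" "b \<noteq> w" "{w, b} \<in> E" "F (insert w A - {w, b})"
      using matchable_remove[of E "insert w A" w] by blast
    have bA: "b \<in> A" using b by blast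
    have "insert w A - {w, b} = A - {b}" using w A by auto
    then have "F (A - {b})" using b(4) by simp
    then have "matchable (edges C) (?s ` (A - {b}))" using single[of "A - {b}"] A by blast
    moreover have "{B, {b}} \<in> edges C" using Bb[of b] bA A w b by blast
    moreover have "B \<notin> ?s ` (A - {b})" "{b} \<notin> ?s ` (A - {b})" "B \<noteq> {b}" using Bs A bA by auto
    ultimately have "matchable (edges C) (insert B (insert {b} (?s ` (A - {b}))))"
      by (intro matchable.insert)
    moreover have "insert {b} (?s ` (A - {b})) = ?s ` A" using bA by auto
    ultimately show "matchable (edges C) (insert B (?s ` A))" by simp
  qed
  have "F (Z - B)"
    using separated_matchable[OF separated_Diff[OF Z(1) separated_H[OF Z(3)]]] by (simp add: B_def)
  moreover have "nodes C - {B} = ?s ` (Z - B)" using Bs nC by simp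
  ultimately have delB: "matchable (edges C) (nodes C - {B})" using single[of "Z - B"] by simp
  have dels: "matchable (edges C) (nodes C - {{v}}) \<longleftrightarrow> (\<exists>w\<in>B. F (insert w (Z - B - {v})))"
    if v: "v \<in> Z - B" for v
  proof -
    have "nodes C - {{v}} = insert B (?s ` (Z - B - {v}))" using v Bs nC by auto
    then show ?thesis using withB[of "Z - B - {v}"] by auto
  qed
  have "nodes (delete_nodes C {{v}}) \<noteq> {}" if "v \<in> Z - B" for v
    using that by (auto simp: nC)
  then have "factor_critical C \<longleftrightarrow> (\<forall>v\<in>Z - B. \<exists>w\<in>B. F (insert w (Z - B - {v})))"
    unfolding factor_critical_def factorizable_delete_nodes[OF sC finC]
    using delB dels by (auto simp: nC)
  then show ?thesis by (simp add: critical_over_def B_def C_def)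
qed

lemma fc_le_iff:
  assumes "x \<in> V" "y \<in> V"
  shows "fc_le (induce G (H x)) G (induce G (H y)) \<longleftrightarrow> below x y"
  unfolding fc_le_def below_def separating_iff nodes_induce_H[OF assms(1)] nodes_induce_H[OF assms(2)]
  using factor_critical_contract_iff[OF _ _ assms(1)] by auto

section \<open>The DM-components of the auxiliary bipartite graph\<close>

text \<open>\<open>G - u\<close> has odd order, so each of its matchings exposes a vertex, and one
  that exposes exactly one vertex is maximum. As such matchings exist, \<open>v\<close> is exposed
  by a maximum matching exactly if \<open>V - {u, v}\<close> is matchable.\<close>

lemma set_D_eq:
  assumes u: "u \<in> V"
  shows "set_D (delete_nodes G {u}) = R u"
proof -
  define G' where "G' = delete_nodes G {u}"
  have sG: "simple_graph G'" using simple by (simp add: G'_def simple_delete_nodes)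
  have fG: "finite (nodes G')" using finite_nodes by (simp add: G'_def)
  have EG: "edges G' \<subseteq> E" by (auto simp: G'_def)
  have nG: "nodes G' = V - {u}" by (simp add: G'_def)
  have "even (card V)" using matchable_even[OF matchable_V] .
  moreover have V1: "card V = Suc (card (V - {u}))"
    by (rule card_Suc_Diff1[OF finite_nodes u, symmetric])
  ultimately have oddV: "odd (card (V - {u}))" by simp
  have bound: "Suc (2 * card N) \<le> card (V - {u})" if "matching G' N" for N
  proof -
    have "\<Union>N \<subseteq> V - {u}" using that sG nG by (auto simp: matching_def simple_graph_def)
    then have "card (\<Union>N) \<le> card (V - {u})" using finite_nodes by (intro card_mono) auto
    moreover have "card (\<Union>N) \<noteq> card (V - {u})"
      using oddV matching_card_Union[OF sG fG that] by (metis dvd_triv_left)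
    ultimately show ?thesis using matching_card_Union[OF sG fG that] by simp
  qed
  have near: "\<exists>M. matching G' M \<and> \<Union>M = V - {u, v} \<and> Suc (2 * card M) = card (V - {u})"
    if "v \<in> R u" for v
  proof -
    have v: "v \<in> V" "v \<noteq> u" "F (V - {u, v})" using that by (auto simp: in_R_iff)
    obtain M where M: "M \<subseteq> E" "\<And>e f. e \<in> M \<Longrightarrow> f \<in> M \<Longrightarrow> e \<noteq> f \<Longrightarrow> e \<inter> f = {}"
      "\<Union>M = V - {u, v}"
      using matchable_matching[OF v(3)] by metis
    have "e \<subseteq> V - {u}" if "e \<in> M" for e using M(3) that by auto
    then have mM: "matching G' M" using M(1,2) by (auto simp: matching_def G'_def)
    have "V - {u, v} = V - {u} - {v}" by auto
    then have "Suc (card (V - {u, v})) = card (V - {u})"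
      using card_Suc_Diff1[of "V - {u}" v] finite_nodes v by simp
    then show ?thesis using mM M(3) matching_card_Union[OF sG fG mM] by metis
  qed
  show ?thesis
  proof
    show "R u \<subseteq> set_D (delete_nodes G {u})"
    proof
      fix v assume v: "v \<in> R u"
      obtain M where M: "matching G' M" "\<Union>M = V - {u, v}" "Suc (2 * card M) = card (V - {u})"
        using near[OF v] by blast
      have "card N \<le> card M" if "matching G' N" for N using bound[OF that] M(3) by simp
      then have "maximum_matching G' M" using M(1) by (simp add: maximum_matching_def)
      moreover have "v \<in> exposed G' M" using v M(2) nG by (auto simp: exposed_def in_R_iff)
      ultimately show "v \<in> set_D (delete_nodes G {u})" by (auto simp: set_D_def G'_def)
    qed
    show "set_D (delete_nodes G {u}) \<subseteq> R u"
    proof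
      fix v assume "v \<in> set_D (delete_nodes G {u})"
      then obtain M where M: "maximum_matching G' M" "v \<in> exposed G' M"
        by (auto simp: set_D_def G'_def)
      have mM: "matching G' M" using M(1) by (simp add: maximum_matching_def)
      obtain m where m: "\<And>a. a \<in> V \<Longrightarrow> {a, m a} \<in> allowed_edges" using mate_V by metis
      \<comment> \<open>This supplies a near-perfect matching of \<open>G - u\<close>, against which
        \<open>M\<close> is compared.\<close>
      have "m u \<in> R u" using m[OF u] allowedD by blast
      then obtain N where N: "matching G' N" "Suc (2 * card N) = card (V - {u})"
        using near by blast
      have "card N \<le> card M" using M(1) N(1) by (simp add: maximum_matching_def)
      then have big: "card (V - {u}) \<le> Suc (card (\<Union>M))"
        using N(2) matching_card_Union[OF sG fG mM] by simp
      have v: "v \<in> V" "v \<noteq> u" "v \<notin> \<Union>M" using M(2) nG by (auto simp: exposed_def)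
      have "\<Union>M \<subseteq> V - {u}" using mM sG nG by (auto simp: matching_def simple_graph_def)
      then have sub: "\<Union>M \<subseteq> V - {u, v}" using v(3) by blast
      have "V - {u, v} = V - {u} - {v}" by auto
      then have "Suc (card (V - {u, v})) = card (V - {u})"
        using card_Suc_Diff1[of "V - {u}" v] finite_nodes v by simp
      then have "\<Union>M = V - {u, v}" using sub big finite_nodes by (intro card_seteq) auto
      then have "F (V - {u, v})"
        using matchable_mono[OF matching_matchable_graph[OF sG fG mM] EG] by simp
      then show "v \<in> R u" using v by (simp add: in_R_iff)
    qed
  qed
qed

lemma set_A_eq:
  assumes "u \<in> V"
  shows "set_A (delete_nodes G {u}) \<union> {u} = X u"
proof -
  have e: "{x, v} \<in> E \<Longrightarrow> x \<in> R u \<Longrightarrow> v \<noteq> u \<Longrightarrow> {x, v} \<subseteq> V - {u}" for x v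
    using edgeD[of x v] not_self_R[of u] by auto
  show ?thesis
    unfolding set_A_def neighbours_def set_D_eq[OF assms] X_def using e assms by auto
qed

section \<open>The odd components left by the barrier \<open>X u\<close>\<close>

lemma component_outside_X:
  assumes "k \<in> R u"
  shows "component E (V - X u) k = K u k"
proof
  show "component E (V - X u) k \<subseteq> K u k"
    using connected_in_K[of _ "V - X u" k u] assms by blast
  show "K u k \<subseteq> component E (V - X u) k"
    using R_subset_V X_R_disjoint by (intro component_mono) blast
qed

text \<open>A component of \<open>G - X u\<close> that meets \<open>R u\<close> is some
  \<open>K u k\<close>, hence odd. Any other one is even: allowed edges at \<open>X u\<close> end in
  \<open>R u\<close>, so none leaves this component, which is therefore separated and
  matchable.\<close>

lemma odd_components_eq:
  assumes u: "u \<in> V"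
  shows "odd_components G (X u) = K u ` R u"
proof -
  let ?W = "V - X u"
  have RW: "R u \<subseteq> ?W" using R_subset_V X_R_disjoint by blast
  have "component_sets (delete_nodes G (X u)) = component {e \<in> E. e \<subseteq> ?W} ?W ` ?W"
    by (subst component_sets_eq) auto
  moreover have "component {e \<in> E. e \<subseteq> ?W} ?W x = component E ?W x" for x
  proof -
    have "adjacency {e \<in> E. e \<subseteq> ?W} ?W = adjacency E ?W" by (auto simp: adjacency_def)
    then show ?thesis by (simp add: component_def)
  qed
  ultimately have cs: "component_sets (delete_nodes G (X u)) = component E ?W ` ?W" by simp
  have ev: "even (card (component E ?W x))" if x: "x \<in> ?W" "x \<notin> R u" for x
  proof -
    let ?C = "component E ?W x"
    have CW: "?C \<subseteq> ?W" using component_subset[OF x(1)] .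
    have CR: "t \<notin> R u" if "t \<in> ?C" for t
    proof
      assume t: "t \<in> R u"
      then have "x \<in> K u t" using component_sym[OF that] component_outside_X by blast
      then show False using K_subset[OF t] x(2) by blast
    qed
    have step: "b \<in> ?C" if ab: "a \<in> ?C" "{a, b} \<in> allowed_edges" for a b
    proof -
      have "b \<notin> X u" using allowed_X[OF u, of b a] CR[OF ab(1)] ab(2) allowed_sym by blast
      then have "b \<in> ?W" "{a, b} \<in> E" using allowedD[OF ab(2)] by auto
      then show ?thesis using component_step[OF ab(1)] CW ab(1) by blast
    qed
    have "H c \<subseteq> ?C" if c: "c \<in> ?C" for c
    proof
      fix y assume "y \<in> H c"
      then show "y \<in> ?C" unfolding H_def by (induction rule: component_induct) (use c step in auto)
    qed
    then have "separated ?C" using CW by (auto simp: separated_def)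
    then show ?thesis using separated_matchable matchable_even by blast
  qed
  show ?thesis
  proof (intro equalityI subsetI)
    fix C assume "C \<in> odd_components G (X u)"
    then obtain x where x: "x \<in> ?W" "C = component E ?W x" "odd (card C)"
      by (auto simp: odd_components_def cs)
    then have "x \<in> R u" using ev by blast
    then show "C \<in> K u ` R u" using component_outside_X x by blast
  next
    fix C assume "C \<in> K u ` R u"
    then obtain k where k: "k \<in> R u" "C = K u k" by blast
    then have "C = component E ?W k" "k \<in> ?W" using component_outside_X RW by auto
    then have "C \<in> component_sets (delete_nodes G (X u))" using cs by blast
    then show "C \<in> odd_components G (X u)"
      using odd_K[OF u k(1)] k(2) by (simp add: odd_components_def)
  qed
qed

section \<open>Nodes, edges and allowed edges of the bipartite graph\<close>

lemma Union_K: "\<Union>(K u ` R u) = R u"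
proof
  show "\<Union>(K u ` R u) \<subseteq> R u" using K_subset by blast
  show "R u \<subseteq> \<Union>(K u ` R u)" using component_self by (intro subsetI UN_I) auto
qed

abbreviation bip_nodes :: "'a \<Rightarrow> 'a set set" where
  "bip_nodes u \<equiv> K u ` R u \<union> (\<lambda>x. {x}) ` X u"

lemma bip_node_eq:
  assumes "P \<in> bip_nodes u" "t \<in> P"
  shows "P = (if t \<in> R u then K u t else {t})"
  using assms(1)
proof
  assume "P \<in> K u ` R u"
  then obtain k where k: "k \<in> R u" "P = K u k" by blast
  then have "t \<in> R u" "K u t = K u k" using assms(2) K_subset component_eq[of t E "R u" k] by auto
  then show ?thesis using k by simp
next
  assume "P \<in> (\<lambda>x. {x}) ` X u"
  then show ?thesis using assms(2) X_R_disjoint by auto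
qed

lemma bip_nodes_disjoint:
  assumes "P \<in> bip_nodes u" "Q \<in> bip_nodes u" "P \<noteq> Q"
  shows "P \<inter> Q = {}"
proof (rule ccontr)
  assume "P \<inter> Q \<noteq> {}"
  then obtain t where "t \<in> P" "t \<in> Q" by blast
  then show False using bip_node_eq assms by metis
qed

lemma C_of_eq: "u \<in> V \<Longrightarrow> C_of G (X u) = V - X u - R u"
  by (simp add: C_of_def D_of_def odd_components_eq Union_K)

lemma nodes_bip:
  assumes u: "u \<in> V"
  shows "nodes (bip_graph G (X u)) = bip_nodes u"
proof -
  have "V - (V - X u - R u) - R u = X u"
    using X_subset_V[OF u] X_R_disjoint by blast
  then show ?thesis
    unfolding bip_graph_def contract_simps contract_nodes_def odd_components_eq[OF u] Union_K
      C_of_eq[OF u]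
    by (simp add: delete_edges_def)
qed

text \<open>An edge inside \<open>R u\<close> stays within one component and becomes a loop, and the
  edges inside \<open>X u\<close> are deleted. What remains joins a barrier vertex to a
  component.\<close>

lemma edges_bip:
  assumes u: "u \<in> V"
  shows "{P, Q} \<in> edges (bip_graph G (X u)) \<longleftrightarrow>
    (\<exists>x\<in>X u. \<exists>k\<in>R u. {x, k} \<in> E \<and> {P, Q} = {{x}, K u k})"
proof -
  define G' where "G' = delete_edges (delete_nodes G (C_of G (X u))) (edges (induce G (X u)))"
  have B: "bip_graph G (X u) = contract G' (K u ` R u)"
    by (simp add: bip_graph_def G'_def odd_components_eq[OF u])
  have cn: "contract_nodes G' (K u ` R u) = bip_nodes u"
    using nodes_bip[OF u] by (simp add: B contract_simps)
  have G'e: "{b, c} \<in> edges G' \<longleftrightarrow> {b, c} \<in> E \<and> {b, c} \<subseteq> X u \<union> R u \<and> \<not> {b, c} \<subseteq> X u" for b c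
    using X_subset_V[OF u] R_subset_V[of u] edgeD[of b c]
    by (auto simp: G'_def delete_edges_def induce_def C_of_eq[OF u])
  note iff = contract_simps(2)[of P Q G' "K u ` R u", folded B, unfolded cn G'e]
  have sing: "P' = {b}" if "P' \<in> bip_nodes u" "b \<in> P'" "b \<notin> R u" for P' b
    using bip_node_eq[OF that(1,2)] that(3) by simp
  have big: "P' = K u b" if "P' \<in> bip_nodes u" "b \<in> P'" "b \<in> R u" for P' b
    using bip_node_eq[OF that(1,2)] that(3) by simp
  show ?thesis
  proof
    assume "{P, Q} \<in> edges (bip_graph G (X u))"
    then obtain b c where *: "P \<in> bip_nodes u" "Q \<in> bip_nodes u" "P \<noteq> Q" "b \<in> P" "c \<in> Q"
      "{b, c} \<in> E" "{b, c} \<subseteq> X u \<union> R u" "\<not> {b, c} \<subseteq> X u"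
      using iff by blast
    consider "b \<in> R u" "c \<in> R u" | "b \<in> R u" "c \<notin> R u" | "b \<notin> R u" "c \<in> R u"
      using *(7,8) by auto
    then show "\<exists>x\<in>X u. \<exists>k\<in>R u. {x, k} \<in> E \<and> {P, Q} = {{x}, K u k}"
    proof cases
      case 1
      then have "c \<in> K u b" using component_step[OF component_self _ _ *(6)] by blast
      then have "K u c = K u b" by (rule component_eq)
      then show ?thesis using big[OF *(1,4) 1(1)] big[OF *(2,5) 1(2)] *(3) by simp
    next
      case 2
      have "{P, Q} = {{c}, K u b}" "{c, b} \<in> E"
        using big[OF *(1,4) 2(1)] sing[OF *(2,5) 2(2)] *(6) by (auto simp: insert_commute)
      then show ?thesis using *(7) 2 by auto
    next
      case 3
      have "{P, Q} = {{b}, K u c}"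
        using big[OF *(2,5) 3(2)] sing[OF *(1,4) 3(1)] by auto
      moreover have "b \<in> X u" using *(7) 3 by auto
      ultimately show ?thesis using *(6) 3 by blast
    qed
  next
    assume "\<exists>x\<in>X u. \<exists>k\<in>R u. {x, k} \<in> E \<and> {P, Q} = {{x}, K u k}"
    then obtain x k where xk: "x \<in> X u" "k \<in> R u" "{x, k} \<in> E" "{P, Q} = {{x}, K u k}" by blast
    have "{x} \<noteq> K u k" using K_subset[OF xk(2)] X_R_disjoint[OF xk(1)] by blast
    moreover have "{x, k} \<subseteq> X u \<union> R u" "\<not> {x, k} \<subseteq> X u" using xk X_R_disjoint by auto
    ultimately have "{{x}, K u k} \<in> edges (bip_graph G (X u))"
      using contract_simps(2)[of "{x}" "K u k" G' "K u ` R u", folded B, unfolded cn G'e]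
        xk(1-3) component_self[of k] by blast
    then show "{P, Q} \<in> edges (bip_graph G (X u))" using xk(4) by simp
  qed
qed

lemma simple_bip: "simple_graph (bip_graph G X')"
  by (simp add: bip_graph_def simple_contract)

lemma finite_bip:
  assumes "u \<in> V"
  shows "finite (nodes (bip_graph G (X u)))"
  unfolding nodes_bip[OF assms]
  by (intro finite_UnI finite_imageI finite_subset[OF X_subset_V[OF assms] finite_nodes]
      finite_subset[OF R_subset_V finite_nodes])

text \<open>An edge from \<open>{x}\<close> to \<open>K u k\<close> is replaced by an edge
  \<open>{x, k}\<close> of \<open>G\<close> together with a perfect matching of
  \<open>K u k - {k}\<close>.\<close>

lemma bip_matchable_lift:
  assumes u: "u \<in> V" and "matchable (edges (bip_graph G (X u))) \<A>" "\<A> \<subseteq> bip_nodes u"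
  shows "F (\<Union>\<A>)"
  using assms(2,3)
proof (induction rule: matchable.induct)
  case (insert \<A> P Q)
  obtain x k where xk: "x \<in> X u" "k \<in> R u" "{x, k} \<in> E" "{P, Q} = {{x}, K u k}"
    using edges_bip[OF u, of P Q] insert.hyps(2) by blast
  have xK: "x \<notin> K u k" using K_subset[OF xk(2)] X_R_disjoint[OF xk(1)] by blast
  have "insert x (K u k) - {x, k} = K u k - {k}" using xK by blast
  then have "F (insert x (K u k) - {x, k})" using factor_critical_K[OF u xk(2)] by simp
  then have "F (insert x (K u k))"
    by (rule matchable_addI) (use xk(3) edgeD[OF xk(3)] component_self[of k] in auto)
  moreover have PQ: "P \<union> Q = insert x (K u k)" using xk(4) by (auto simp: doubleton_eq_iff)
  ultimately have FPQ: "F (P \<union> Q)" by simp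
  have "P \<inter> A = {} \<and> Q \<inter> A = {}" if A: "A \<in> \<A>" for A
  proof -
    have "P \<noteq> A" "Q \<noteq> A" using insert.hyps(4,5) A by blast+
    moreover have "P \<in> bip_nodes u" "Q \<in> bip_nodes u" "A \<in> bip_nodes u"
      using insert.prems A by blast+
    ultimately show ?thesis by (intro conjI bip_nodes_disjoint)
  qed
  then have disj: "(P \<union> Q) \<inter> \<Union>\<A> = {}" by blast
  have "F (\<Union>\<A>)" using insert.IH insert.prems by blast
  then have "F ((P \<union> Q) \<union> \<Union>\<A>)" by (rule matchable_Un[OF FPQ _ disj])
  then show ?case by (simp add: Un_assoc)
qed (auto intro: matchable.empty)

text \<open>From left to right, the matching of the remaining nodes is lifted and completed inside
  \<open>K u k\<close> and on the vertices outside \<open>X u \<union> R u\<close>. From right to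
  left, a perfect matching of \<open>G\<close> through \<open>{x, l}\<close> induces a bijection
  from \<open>X u\<close> to the components, and this is a perfect matching of the bipartite
  graph.\<close>

lemma allowed_bip:
  assumes u: "u \<in> V" and x: "x \<in> X u" and k: "k \<in> R u"
  shows "allowed (bip_graph G (X u)) {{x}, K u k} \<longleftrightarrow> (\<exists>l\<in>K u k. {x, l} \<in> allowed_edges)"
proof -
  let ?B = "bip_graph G (X u)"
  note al = allowed_iff[OF simple_bip finite_bip[OF u], unfolded nodes_bip[OF u]]
  have UB: "\<Union>(bip_nodes u) = X u \<union> R u" using Union_K[of u] by auto
  show ?thesis
  proof
    assume "allowed ?B {{x}, K u k}"
    then have e: "{{x}, K u k} \<in> edges ?B" "matchable (edges ?B) (bip_nodes u - {{x}, K u k})"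
      using al by auto
    \<comment> \<open>The end \<open>l\<close> of an edge representing the contracted one need not
      be \<open>k\<close>; it is the vertex that the matching inside the component has to
      omit.\<close>
    obtain y l where yl: "y \<in> X u" "l \<in> R u" "{y, l} \<in> E" "{{x}, K u k} = {{y}, K u l}"
      using edges_bip[OF u, of "{x}" "K u k"] e(1) by blast
    have "{x} \<noteq> K u l" using K_subset[OF yl(2)] X_R_disjoint[OF x] by blast
    then have y: "y = x" and Kl: "K u k = K u l" using yl(4) by (auto simp: doubleton_eq_iff)
    have lK: "l \<in> K u k" using Kl component_self[of l] by simp
    have "F (\<Union>(bip_nodes u - {{x}, K u k}))" using bip_matchable_lift[OF u e(2)] by blast
    moreover have "\<Union>(bip_nodes u - {{x}, K u k}) = X u \<union> R u - {x} - K u k"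
    proof
      show "\<Union>(bip_nodes u - {{x}, K u k}) \<subseteq> X u \<union> R u - {x} - K u k"
      proof
        fix t assume "t \<in> \<Union>(bip_nodes u - {{x}, K u k})"
        then obtain P where P: "P \<in> bip_nodes u" "P \<noteq> {x}" "P \<noteq> K u k" "t \<in> P" by blast
        have "P \<inter> {x} = {}" "P \<inter> K u k = {}" using bip_nodes_disjoint[OF P(1)] P(2,3) x k by auto
        then show "t \<in> X u \<union> R u - {x} - K u k" using P UB by blast
      qed
      show "X u \<union> R u - {x} - K u k \<subseteq> \<Union>(bip_nodes u - {{x}, K u k})"
      proof
        fix t assume t: "t \<in> X u \<union> R u - {x} - K u k"
        then obtain P where P: "P \<in> bip_nodes u" "t \<in> P" using UB by blast
        then have "P \<noteq> {x}" "P \<noteq> K u k" using t by auto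
        then show "t \<in> \<Union>(bip_nodes u - {{x}, K u k})" using P by blast
      qed
    qed
    ultimately have 1: "F (X u \<union> R u - {x} - K u k)" by simp
    \<comment> \<open>This set is the part \<open>C(G - u)\<close> of the Gallai-Edmonds
      decomposition; no allowed edge joins it to the other two parts.\<close>
    have "separated (V - X u - R u)"
    proof -
      have "H y \<subseteq> V - X u - R u" if y: "y \<in> V - X u - R u" for y
      proof
        fix t assume t: "t \<in> H y"
        have "t \<notin> X u" using H_subset_X_R[OF u, of t] H_sym[OF t] y by blast
        moreover have "t \<notin> R u"
        proof
          assume tR: "t \<in> R u"
          have "y \<notin> X u \<union> R u" using y by blast
          then obtain a b where
            ab: "{a, b} \<in> allowed_edges" "a \<in> X u \<union> R u" "b \<notin> X u \<union> R u"
            using H_leave[OF H_sym[OF t], of "X u \<union> R u"] tR by blast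
          then show False
            using allowed_X[OF u, of a b] R_neighbour[of a u b] allowedD[OF ab(1)] by blast
        qed
        ultimately show "t \<in> V - X u - R u" using t H_subset_V y by blast
      qed
      then show ?thesis by (auto simp: separated_def)
    qed
    then have 2: "F (V - X u - R u)" by (rule separated_matchable)
    have 3: "F (K u k - {l})" using factor_critical_K_at[OF u k lK] .
    have KR: "K u k \<subseteq> R u" using K_subset[OF k] .
    have d: "(X u \<union> R u - {x} - K u k) \<inter> (V - X u - R u) = {}" by blast
    have d': "((X u \<union> R u - {x} - K u k) \<union> (V - X u - R u)) \<inter> (K u k - {l}) = {}"
      using KR by blast
    have "F (((X u \<union> R u - {x} - K u k) \<union> (V - X u - R u)) \<union> (K u k - {l}))"
      by (rule matchable_Un[OF matchable_Un[OF 1 2 d] 3 d'])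
    moreover have "((X u \<union> R u - {x} - K u k) \<union> (V - X u - R u)) \<union> (K u k - {l}) = V - {x, l}"
      using KR lK R_subset_V[of u] X_subset_V[OF u] X_R_disjoint[OF x] x by auto
    ultimately have "F (V - {x, l})" by simp
    then show "\<exists>l\<in>K u k. {x, l} \<in> allowed_edges" using yl(3) y lK by (auto simp: allowed_edges_def)
  next
    assume "\<exists>l\<in>K u k. {x, l} \<in> allowed_edges"
    then obtain l where l: "l \<in> K u k" "{x, l} \<in> allowed_edges" by blast
    obtain m where m: "m x = l" "\<And>a. a \<in> V \<Longrightarrow> m (m a) = a"
      "\<And>a. a \<in> V \<Longrightarrow> {a, m a} \<in> allowed_edges"
      "\<And>T. T \<subseteq> V \<Longrightarrow> m ` T \<subseteq> T \<Longrightarrow> F (V - T)"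
      using mate_V_extends[OF l(2)] by metis
    have XV: "X u \<subseteq> V" using X_subset_V[OF u] .
    define f where "f = (\<lambda>y. K u (m y))"
    have mR: "m y \<in> R u" if "y \<in> X u" for y
      using allowed_X[OF u that m(3)] that XV by blast
    have fx: "f x = K u k" using component_eq[OF l(1)] m(1) by (simp add: f_def)
    have inj: "inj_on f (X u)"
    proof (rule inj_onI, rule ccontr)
      fix a b assume *: "a \<in> X u" "b \<in> X u" "f a = f b" "a \<noteq> b"
      have "m b \<notin> K u (m a)" using *(1,2,4) m(2-4) by (intro mates_distinct_K[OF u])
      then show False using *(3) component_self[of "m b"] unfolding f_def by simp
    qed
    have img: "f ` X u = K u ` R u"
    proof
      show "f ` X u \<subseteq> K u ` R u" using mR by (auto simp: f_def)
      show "K u ` R u \<subseteq> f ` X u"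
      proof
        fix C assume "C \<in> K u ` R u"
        then obtain t where t: "t \<in> R u" "C = K u t" by blast
        obtain y where "y \<in> X u" "m y \<in> K u t" using mates_cover_K[OF u t(1) m(2,3)] by blast
        then show "C \<in> f ` X u" using component_eq[of "m y" E "R u" t] t(2) by (auto simp: f_def)
      qed
    qed
    have sf: "{y} \<notin> f ` X u" if "y \<in> X u" for y
    proof
      assume "{y} \<in> f ` X u"
      then have "{y} \<in> K u ` R u" using img by simp
      then obtain t where "{y} = K u t" "t \<in> R u" by (rule imageE)
      then show False using K_subset[of t u] X_R_disjoint[OF that] by blast
    qed
    have ed: "{{y}, f y} \<in> edges ?B" if "y \<in> X u" for y
    proof -
      have "{y, m y} \<in> E" using allowedD[OF m(3)[of y]] XV that by blast
      then show ?thesis unfolding edges_bip[OF u] f_def using mR[OF that] that by blast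
    qed
    have build: "matchable (edges ?B) ((\<lambda>y. {y}) ` Y \<union> f ` Y)" if "finite Y" "Y \<subseteq> X u" for Y
      using that
    proof (induction Y rule: finite_induct)
      case (insert y Y)
      have y: "y \<in> X u" "Y \<subseteq> X u" using insert.prems by auto
      have "f y \<notin> f ` Y" using inj_on_image_mem_iff[OF inj y(1) y(2)] insert.hyps(2) by simp
      moreover have "f y \<noteq> {z}" if "z \<in> X u" for z using sf[OF that] y(1) by (metis imageI)
      then have "f y \<notin> (\<lambda>y. {y}) ` Y" "{y} \<noteq> f y" using y by auto
      moreover have "{y} \<notin> (\<lambda>y. {y}) ` Y" using insert.hyps(2) by auto
      moreover have "{y} \<notin> f ` Y" using sf[OF y(1)] y(2) by blast
      ultimately have "matchable (edges ?B) (insert {y} (insert (f y) ((\<lambda>y. {y}) ` Y \<union> f ` Y)))"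
        using ed[OF y(1)] insert.IH[OF y(2)] by (intro matchable.insert) auto
      then show ?case by (simp add: insert_commute)
    qed (auto intro: matchable.empty)
    have "bip_nodes u - {{x}, K u k} = (\<lambda>y. {y}) ` (X u - {x}) \<union> f ` (X u - {x})"
    proof -
      have 1: "f ` (X u - {x}) = K u ` R u - {K u k}"
        using inj_on_image_set_diff[OF inj, of "X u" "{x}"] x fx img by simp
      have 2: "(\<lambda>y. {y}) ` (X u - {x}) = (\<lambda>y. {y}) ` X u - {{x}}" by auto
      have 3: "{x} \<notin> K u ` R u" using sf[OF x] img by simp
      have 4: "K u k \<notin> (\<lambda>y. {y}) ` X u"
      proof
        assume "K u k \<in> (\<lambda>y. {y}) ` X u"
        then obtain y where "K u k = {y}" "y \<in> X u" by (rule imageE)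
        then show False using sf[of y] fx x by (metis imageI)
      qed
      show ?thesis unfolding 1 2 using 3 4 by blast
    qed
    then have "matchable (edges ?B) (bip_nodes u - {{x}, K u k})"
      using build[of "X u - {x}"] finite_subset[OF XV finite_nodes] by simp
    then show "allowed ?B {{x}, K u k}" using ed[OF x] fx al by simp
  qed
qed

text \<open>The nodes of the DM-component of \<open>{x}\<close> that are contracted components are
  those meeting \<open>H x\<close>. Both inclusions follow by walking along allowed edges, once in
  the bipartite graph (\<open>into\<close>) and once in \<open>G\<close>
  (\<open>onto\<close>).\<close>

lemma DM_component_arcs:
  assumes u: "u \<in> V" and D: "D \<in> factor_components (bip_graph G (X u))"
    and x: "x \<in> X_part (X u) D"
  shows "x \<in> X u" "nodes (expansion G (X u) D) - X u = arcs_from u x"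
proof -
  let ?B = "bip_graph G (X u)"
  define AE where "AE = {e. allowed ?B e}"
  let ?comp = "component AE (bip_nodes u)"
  show xX: "x \<in> X u" using x by (simp add: X_part_def)
  have AEe: "e \<in> edges ?B" if "e \<in> AE" for e using that by (simp add: AE_def allowed_def)
  have AEsub: "e \<subseteq> bip_nodes u" if "e \<in> AE" for e
    using simple_graph_edge[OF simple_bip AEe[OF that]] nodes_bip[OF u] by simp
  have "component_sets (allowed_subgraph ?B) = ?comp ` bip_nodes u"
    using component_sets_eq[of "allowed_subgraph ?B"] AEsub nodes_bip[OF u]
    by (simp add: allowed_subgraph_def AE_def)
  then obtain N where N: "N \<in> bip_nodes u" "D = induce ?B (?comp N)"
    using D by (auto simp: factor_components_def)
  have "nodes D = bip_nodes u \<inter> ?comp N"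
    using N(2) nodes_bip[OF u] by (simp add: induce_def)
  moreover have "?comp N \<subseteq> bip_nodes u" using component_subset[OF N(1)] .
  ultimately have "nodes D = ?comp N" by (simp add: Int_absorb1)
  moreover have "{x} \<in> nodes D" using x by (simp add: X_part_def)
  ultimately have nD: "nodes D = ?comp {x}" using component_eq by metis
  \<comment> \<open>If the component meets \<open>H x\<close>, it has an allowed exit in
    \<open>H x\<close>, and all its allowed exits belong to the same factor-component.\<close>
  have allowed_H: "z \<in> H x \<longleftrightarrow> K u k \<inter> H x \<noteq> {}"
    if zk: "z \<in> X u" "k \<in> R u" "{{z}, K u k} \<in> AE" for z k
  proof -
    obtain l where l: "l \<in> K u k" "{z, l} \<in> allowed_edges"
      using allowed_bip[OF u zk(1,2)] zk(3) by (auto simp: AE_def)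
    show ?thesis
    proof
      assume "z \<in> H x"
      then show "K u k \<inter> H x \<noteq> {}" using H_step l by blast
    next
      assume "K u k \<inter> H x \<noteq> {}"
      then obtain t where t: "t \<in> K u k" "t \<in> H x" by blast
      have Kt: "K u t = K u k" using component_eq[OF t(1)] .
      have tR: "t \<in> R u" using t K_subset[OF zk(2)] by blast
      obtain y n where yn: "y \<in> X u" "y \<in> H x" "n \<in> K u t" "n \<in> H x" "{y, n} \<in> allowed_edges"
        using exit_exists[OF u tR t(2) xX] by blast
      have "l \<in> K u n" using component_eq[OF yn(3)] Kt l(1) by simp
      then have "H l = H n" using exits_same_H[OF u yn(1,5) zk(1) l(2)] by blast
      then have "H z = H x" using H_eq[OF mate_in_H[OF l(2)]] H_eq[OF yn(4)] by simp
      then show "z \<in> H x" using H_self[of z] by simp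
    qed
  qed
  have into: "P \<inter> H x \<noteq> {}" if "P \<in> ?comp {x}" for P
    using that
  proof (induction rule: component_induct)
    case (step P Q)
    obtain z k where zk: "z \<in> X u" "k \<in> R u" "{P, Q} = {{z}, K u k}"
      using edges_bip[OF u, of P Q] AEe[OF step(4)] by blast
    have "{{z}, K u k} \<in> AE" using step(4) zk(3) by simp
    then have "{z} \<inter> H x \<noteq> {} \<longleftrightarrow> K u k \<inter> H x \<noteq> {}" using allowed_H[OF zk(1,2)] by simp
    then show ?case using step(5) zk(3) by (auto simp: doubleton_eq_iff)
  qed simp
  have onto: "(y \<in> X u \<and> {y} \<in> ?comp {x}) \<or> (y \<in> R u \<and> K u y \<in> ?comp {x})" if "y \<in> H x" for y
    using that[unfolded H_def]
  proof (induction rule: component_induct)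
    case (step a b)
    have bn: "b \<in> X u \<Longrightarrow> {b} \<in> bip_nodes u" "b \<in> R u \<Longrightarrow> K u b \<in> bip_nodes u"
      "a \<in> X u \<Longrightarrow> {a} \<in> bip_nodes u" "a \<in> R u \<Longrightarrow> K u a \<in> bip_nodes u" by auto
    from step(5) show ?case
    proof
      assume a: "a \<in> X u \<and> {a} \<in> ?comp {x}"
      then have bR: "b \<in> R u" using allowed_X[OF u] step(4) by blast
      have "{{a}, K u b} \<in> AE"
        using allowed_bip[OF u _ bR, of a] a step(4) component_self[of b] by (auto simp: AE_def)
      then have "K u b \<in> ?comp {x}"
        using component_step[of "{a}" AE "bip_nodes u" "{x}" "K u b"] a bn bR by blast
      then show ?thesis using bR by blast
    next
      assume a: "a \<in> R u \<and> K u a \<in> ?comp {x}"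
      have abE: "{a, b} \<in> E" using allowedD[OF step(4)] by blast
      show ?thesis
      proof (cases "b \<in> X u")
        case True
        have "\<exists>l\<in>K u a. {b, l} \<in> allowed_edges"
          using step(4) component_self[of a] by (auto simp: insert_commute)
        then have "{{b}, K u a} \<in> AE" using allowed_bip[OF u True] a by (auto simp: AE_def)
        then have "{b} \<in> ?comp {x}"
          using component_step[of "K u a" AE "bip_nodes u" "{x}" "{b}"] a bn True
          by (auto simp: insert_commute)
        then show ?thesis using True by blast
      next
        case False
        \<comment> \<open>An allowed edge inside \<open>R u\<close> is contracted, so the walk stays
          at the same node.\<close>
        then have "b \<in> R u" "b \<in> K u a"
          using R_neighbour[of a u b] K_step[of a u a b] component_self[of a] a abE by blast+
        then show ?thesis using a component_eq[of b E "R u" a] by simp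
      qed
    qed
  qed (use xX in simp)
  have XV: "X u \<subseteq> V" using X_subset_V[OF u] .
  have iff: "K u k \<in> nodes D \<longleftrightarrow> K u k \<inter> H x \<noteq> {}" if k: "k \<in> R u" for k
  proof
    assume "K u k \<inter> H x \<noteq> {}"
    then obtain t where t: "t \<in> K u k" "t \<in> H x" by blast
    then have "t \<in> R u" using K_subset[OF k] by blast
    then show "K u k \<in> nodes D"
      using onto[OF t(2)] component_eq[OF t(1)] X_R_disjoint nD by auto
  qed (use into nD in blast)
  have Xp: "X_part (X u) D \<subseteq> X u" by (auto simp: X_part_def)
  have "nodes (expansion G (X u) D) - X u = \<Union>{C \<in> K u ` R u. C \<in> nodes D}"
  proof -
    have "\<Union>{C \<in> K u ` R u. C \<in> nodes D} \<subseteq> R u" using K_subset by blast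
    then have "\<Union>{C \<in> K u ` R u. C \<in> nodes D} \<subseteq> V - X u" using R_subset_V X_R_disjoint by blast
    then show ?thesis
      unfolding expansion_def induce_def odd_components_eq[OF u] using Xp by auto
  qed
  also have "\<dots> = arcs_from u x"
  proof (intro equalityI subsetI)
    fix y assume "y \<in> \<Union>{C \<in> K u ` R u. C \<in> nodes D}"
    then obtain k where k: "k \<in> R u" "K u k \<in> nodes D" "y \<in> K u k" by blast
    then obtain t where t: "t \<in> K u k" "t \<in> H x" using iff by blast
    then have "t \<in> R u" "y \<in> K u t" using K_subset[OF k(1)] component_eq[OF t(1)] k(3) by auto
    then show "y \<in> arcs_from u x" using t(2) by (auto simp: arcs_from_def)
  next
    fix y assume "y \<in> arcs_from u x"
    then obtain k where k: "k \<in> R u" "k \<in> H x" "y \<in> K u k" by (auto simp: arcs_from_def)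
    then have "K u k \<in> nodes D" using iff component_self[of k] by blast
    then show "y \<in> \<Union>{C \<in> K u ` R u. C \<in> nodes D}" using k by blast
  qed
  finally show "nodes (expansion G (X u) D) - X u = arcs_from u x" .
qed

section \<open>The algorithm\<close>

text \<open>The last two conjuncts become the assumptions of \<open>reach_iff_below\<close>; the
  second of them is limited to vertices already removed from \<open>U\<close>, which at the end are
  all vertices. The first ensures that a chosen \<open>u\<close> is a vertex of
  \<open>G\<close>.\<close>

definition invar :: "'a alg_state \<Rightarrow> bool" where
  "invar s \<longleftrightarrow> var_U s \<subseteq> V \<and>
    (\<forall>(x, y)\<in>var_A s. \<exists>u\<in>V. x \<in> X u \<and> y \<in> arcs_from u x) \<and>
    (\<forall>x\<in>V - var_U s. \<exists>u\<in>V. x \<in> X u \<and> {x} \<times> arcs_from u x \<subseteq> var_A s)"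

text \<open>The heads computed from the DM-component are the same for every \<open>x\<close> in its
  class, namely \<open>arcs_from u x\<close>, so the added product of sets consists of correct and
  complete arc sets.\<close>

lemma invar_register:
  assumes u: "u \<in> V" and D: "D \<in> factor_components (bip_graph G (X u))" and s: "invar s"
  shows "invar (register G (X u) D s)"
proof -
  let ?S = "X_part (X u) D" and ?T = "nodes (expansion G (X u) D) - X u"
  have S: "x \<in> X u \<and> ?T = arcs_from u x" if "x \<in> ?S" for x
    using DM_component_arcs[OF u D that] by simp
  have U: "var_U (register G (X u) D s) = var_U s - ?S"
    and A: "var_A (register G (X u) D s) = var_A s \<union> ?S \<times> ?T"
    by (simp_all add: register_def)
  show ?thesis
    unfolding invar_def U A
  proof (intro conjI)
    show "var_U s - ?S \<subseteq> V" using s by (auto simp: invar_def)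
    have "\<exists>u\<in>V. x \<in> X u \<and> y \<in> arcs_from u x" if "(x, y) \<in> var_A s \<union> ?S \<times> ?T" for x y
    proof (cases "(x, y) \<in> var_A s")
      case True
      then show ?thesis using s by (auto simp: invar_def)
    next
      case False
      then have "x \<in> ?S" "y \<in> ?T" using that by auto
      then show ?thesis using S[of x] u by auto
    qed
    then show "\<forall>(x, y)\<in>var_A s \<union> ?S \<times> ?T. \<exists>u\<in>V. x \<in> X u \<and> y \<in> arcs_from u x" by blast
    show "\<forall>x\<in>V - (var_U s - ?S). \<exists>u\<in>V. x \<in> X u \<and> {x} \<times> arcs_from u x \<subseteq> var_A s \<union> ?S \<times> ?T"
    proof
      fix x assume x: "x \<in> V - (var_U s - ?S)"
      show "\<exists>u\<in>V. x \<in> X u \<and> {x} \<times> arcs_from u x \<subseteq> var_A s \<union> ?S \<times> ?T"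
      proof (cases "x \<in> ?S")
        case True
        then have "x \<in> X u" "{x} \<times> arcs_from u x \<subseteq> ?S \<times> ?T" using S[OF True] by auto
        then show ?thesis using u by blast
      next
        case False
        then obtain v where "v \<in> V" "x \<in> X v" "{x} \<times> arcs_from v x \<subseteq> var_A s"
          using x s unfolding invar_def by blast
        then show ?thesis by blast
      qed
    qed
  qed
qed

lemma invar_for_each:
  assumes "for_each_component G (X u) \<D> s s'" "u \<in> V"
    "\<D> \<subseteq> factor_components (bip_graph G (X u))" "invar s"
  shows "invar s'"
  using assms
proof (induction rule: for_each_component.induct)
  case (for_step D \<D> s s' s'')
  have "invar (register G (X u) D s)"
    using for_step.hyps(1) for_step.prems by (intro invar_register) auto
  with for_step.hyps(2) have "invar s'" by cases (use \<open>invar s\<close> in auto)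
  then show ?case using for_step by blast
qed simp

lemma invar_while: "while_loop G s s' \<Longrightarrow> invar s \<Longrightarrow> invar s' \<and> var_U s' = {}"
proof (induction rule: while_loop.induct)
  case (while_step u s Y s' s'')
  have u: "u \<in> V" using while_step by (auto simp: invar_def)
  have "Y = X u" using while_step.hyps(2) set_A_eq[OF u] by simp
  then have "invar s'" using invar_for_each[OF _ u subset_refl] while_step by blast
  then show ?case using while_step.IH by blast
qed simp

lemma algorithm_reach:
  assumes "algorithm_output G \<P> Aux"
  shows "wf_digraph (with_proj Aux)" "verts (with_proj Aux) = V"
    "x \<rightarrow>\<^sup>*\<^bsub>with_proj Aux\<^esub> y \<longleftrightarrow> x \<in> V \<and> y \<in> V \<and> below x y"
proof -
  obtain s where s: "while_loop G \<lparr>var_U = V, var_f = (\<lambda>_. 0), var_A = {}, var_P = {}\<rparr> s"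
    "Aux = \<lparr>pverts = V, parcs = var_A s\<rparr>"
    using assms by (auto simp: algorithm_output_def)
  have inv: "invar s" "var_U s = {}"
    using invar_while[OF s(1)] by (auto simp: invar_def)
  have sound: "\<exists>u\<in>V. a \<in> X u \<and> b \<in> arcs_from u a" if "(a, b) \<in> var_A s" for a b
    using inv(1) that by (auto simp: invar_def)
  have complete: "\<exists>u\<in>V. a \<in> X u \<and> {a} \<times> arcs_from u a \<subseteq> var_A s" if "a \<in> V" for a
    using inv that by (simp add: invar_def)
  have AV: "a \<in> V \<and> b \<in> V" if ab: "(a, b) \<in> var_A s" for a b
  proof -
    obtain u where u: "u \<in> V" "a \<in> X u" "b \<in> arcs_from u a" using sound[OF ab] by blast
    then obtain k where "k \<in> R u" "b \<in> K u k" by (auto simp: arcs_from_def)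
    then have "b \<in> V" using K_subset R_subset_V by blast
    then show ?thesis using u X_subset_V by blast
  qed
  show vV: "verts (with_proj Aux) = V" by (simp add: s(2))
  show wf: "wf_digraph (with_proj Aux)"
    by unfold_locales (use AV in \<open>auto simp: s(2)\<close>)
  have "x \<rightarrow>\<^sup>*\<^bsub>with_proj Aux\<^esub> y \<longleftrightarrow> x \<in> V \<and> y \<in> V \<and> (x, y) \<in> (var_A s)\<^sup>*"
  proof
    assume r: "x \<rightarrow>\<^sup>*\<^bsub>with_proj Aux\<^esub> y"
    then have "(x, y) \<in> (var_A s)\<^sup>*" using reachable_rtranclI[OF r] by (simp add: s(2))
    then show "x \<in> V \<and> y \<in> V \<and> (x, y) \<in> (var_A s)\<^sup>*"
      using wf_digraph.reachable_in_verts[OF wf r] vV by simp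
  next
    assume r: "x \<in> V \<and> y \<in> V \<and> (x, y) \<in> (var_A s)\<^sup>*"
    then have "(x, y) \<in> (var_A s)\<^sup>*" by blast
    then show "x \<rightarrow>\<^sup>*\<^bsub>with_proj Aux\<^esub> y"
    proof (induction rule: rtrancl_induct)
      case base
      then show ?case using r by (simp add: reachable_def s(2))
    next
      case (step a b)
      then have "a \<rightarrow>\<^bsub>with_proj Aux\<^esub> b" by (simp add: s(2))
      then show ?case using wf_digraph.reachable_adj_trans[OF wf step.IH] by blast
    qed
  qed
  then show "x \<rightarrow>\<^sup>*\<^bsub>with_proj Aux\<^esub> y \<longleftrightarrow> x \<in> V \<and> y \<in> V \<and> below x y"
    using reach_iff_below[of "var_A s" x y, OF sound complete] by blast
qed

text \<open>By antisymmetry of the order, mutual reachability means lying in the same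
  factor-component.\<close>

lemma algorithm_sccs:
  assumes "algorithm_output G \<P> Aux"
  shows "verts ` pre_digraph.sccs (with_proj Aux) = H ` V"
proof -
  note reach = algorithm_reach(3)[OF assms]
  have H_reach: "x \<rightarrow>\<^sup>*\<^bsub>with_proj Aux\<^esub> y \<and> y \<rightarrow>\<^sup>*\<^bsub>with_proj Aux\<^esub> x \<longleftrightarrow> x \<in> V \<and> y \<in> H x" for x y
  proof
    assume "x \<rightarrow>\<^sup>*\<^bsub>with_proj Aux\<^esub> y \<and> y \<rightarrow>\<^sup>*\<^bsub>with_proj Aux\<^esub> x"
    then have "x \<in> V" "H x = H y" using reach below_antisym by blast+
    then show "x \<in> V \<and> y \<in> H x" using H_self[of y] by simp
  next
    assume xy: "x \<in> V \<and> y \<in> H x"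
    then have "y \<in> V" "H y = H x" using H_subset_V H_eq by auto
    then show "x \<rightarrow>\<^sup>*\<^bsub>with_proj Aux\<^esub> y \<and> y \<rightarrow>\<^sup>*\<^bsub>with_proj Aux\<^esub> x"
      using xy reach below_if_same_H[of x y] below_if_same_H[of y x] by simp
  qed
  have "S \<in> pre_digraph.sccs_verts (with_proj Aux) \<longleftrightarrow> S \<in> H ` V" for S
  proof
    assume "S \<in> pre_digraph.sccs_verts (with_proj Aux)"
    then have S: "S \<noteq> {}" "\<forall>u\<in>S. \<forall>v\<in>S. u \<rightarrow>\<^sup>*\<^bsub>with_proj Aux\<^esub> v"
      "\<forall>u\<in>S. \<forall>v. v \<notin> S \<longrightarrow> \<not> u \<rightarrow>\<^sup>*\<^bsub>with_proj Aux\<^esub> v \<or> \<not> v \<rightarrow>\<^sup>*\<^bsub>with_proj Aux\<^esub> u"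
      by (auto simp: pre_digraph.sccs_verts_def)
    then obtain x where x: "x \<in> S" by blast
    have "y \<in> S \<longleftrightarrow> y \<in> H x" for y using S(2,3) x H_reach by metis
    then have "S = H x" by blast
    moreover have "x \<in> V" using S(2) x reach by blast
    ultimately show "S \<in> H ` V" by blast
  next
    assume "S \<in> H ` V"
    then obtain x where x: "x \<in> V" "S = H x" by blast
    have Hu: "H u = S" "u \<in> V" if "u \<in> S" for u using that x H_eq[of u x] H_subset_V by auto
    have "u \<rightarrow>\<^sup>*\<^bsub>with_proj Aux\<^esub> v" if "u \<in> S" "v \<in> S" for u v
      using H_reach[of u v] Hu that by simp
    moreover have "\<not> u \<rightarrow>\<^sup>*\<^bsub>with_proj Aux\<^esub> v \<or> \<not> v \<rightarrow>\<^sup>*\<^bsub>with_proj Aux\<^esub> u" if "u \<in> S" "v \<notin> S" for u v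
      using H_reach[of u v] Hu that by simp
    moreover have "S \<noteq> {}" using x H_self by blast
    ultimately show "S \<in> pre_digraph.sccs_verts (with_proj Aux)"
      by (simp add: pre_digraph.sccs_verts_def)
  qed
  then have "pre_digraph.sccs_verts (with_proj Aux) = H ` V" by blast
  then show ?thesis using wf_digraph.sccs_verts_conv[OF algorithm_reach(1)[OF assms]] by simp
qed

end

theorem theorem12:
  fixes G :: "'a ugraph" and \<P> :: "'a set set" and Aux :: "'a pair_pre_digraph"
  assumes "finite_graph G"
    and "factorizable G"
    and "algorithm_output G \<P> Aux"
  shows "(\<forall>H. sub_ugraph H G \<longrightarrow>
            (H \<in> factor_components G \<longleftrightarrow>
             (\<exists>D \<in> pre_digraph.sccs (with_proj Aux). H = induce G (verts D))))
       \<and> nodes ` factor_components G = verts ` pre_digraph.sccs (with_proj Aux)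
       \<and> (\<forall>H\<^sub>1 \<in> factor_components G. \<forall>H\<^sub>2 \<in> factor_components G.
            \<forall>D\<^sub>1 \<in> pre_digraph.sccs (with_proj Aux). \<forall>D\<^sub>2 \<in> pre_digraph.sccs (with_proj Aux).
              verts D\<^sub>1 = nodes H\<^sub>1 \<longrightarrow> verts D\<^sub>2 = nodes H\<^sub>2 \<longrightarrow>
              (H\<^sub>1 \<unlhd>\<^bsub>G\<^esub> H\<^sub>2 \<longleftrightarrow>
               (\<forall>u \<in> verts D\<^sub>1. \<forall>v \<in> verts D\<^sub>2. u \<rightarrow>\<^sup>*\<^bsub>with_proj Aux\<^esub> v)))"
proof -
  interpret factorizable_graph G using assms by unfold_locales
  have sccs: "verts ` pre_digraph.sccs (with_proj Aux) = H ` nodes G"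
    using algorithm_sccs[OF assms(3)] .
  have "factor_components G = induce G ` H ` nodes G"
    by (simp add: factor_components_eq image_image)
  also have "\<dots> = (\<lambda>D. induce G (verts D)) ` pre_digraph.sccs (with_proj Aux)"
    unfolding sccs[symmetric] by (simp add: image_image)
  finally have "factor_components G = (\<lambda>D. induce G (verts D)) ` pre_digraph.sccs (with_proj Aux)" .
  then have 1: "C \<in> factor_components G \<longleftrightarrow>
      (\<exists>D \<in> pre_digraph.sccs (with_proj Aux). C = induce G (verts D))" for C
    by auto
  have 2: "nodes ` factor_components G = H ` nodes G"
    unfolding factor_components_eq image_image using nodes_induce_H by (intro image_cong) auto
  have 3: "fc_le C1 G C2 \<longleftrightarrow> (\<forall>u\<in>nodes C1. \<forall>v\<in>nodes C2. u \<rightarrow>\<^sup>*\<^bsub>with_proj Aux\<^esub> v)"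
    if C: "C1 \<in> factor_components G" "C2 \<in> factor_components G" for C1 C2
  proof -
    obtain x y where xy: "x \<in> nodes G" "C1 = induce G (H x)" "y \<in> nodes G" "C2 = induce G (H y)"
      using C by (auto simp: factor_components_eq)
    have N: "nodes C1 = H x" "nodes C2 = H y" using xy nodes_induce_H by auto
    \<comment> \<open>The order depends only on the factor-components of its arguments, so
      reachability for all pairs amounts to the single statement \<open>below x y\<close>.\<close>
    have bel: "below u v \<longleftrightarrow> below x y" if "u \<in> H x" "v \<in> H y" for u v
      using H_eq[OF that(1)] H_eq[OF that(2)] by (simp add: below_def)
    have "(\<forall>u\<in>H x. \<forall>v\<in>H y. u \<rightarrow>\<^sup>*\<^bsub>with_proj Aux\<^esub> v) \<longleftrightarrow> below x y"
      using algorithm_reach(3)[OF assms(3)] bel H_subset_V[OF xy(1)] H_subset_V[OF xy(3)]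
        H_self[of x] H_self[of y] by (metis subsetD)
    then show ?thesis using fc_le_iff[OF xy(1,3)] by (simp add: N[unfolded xy(2,4)] xy(2,4))
  qed
  show ?thesis using 1 2 3 sccs by simp
qed

end
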